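(* Let $L$ be a Lie algebra over a field. Then the ordinary universal enveloping algebra $U(L)$ is semiperfect if and only if $L=0$.
   Context: For a ring $R$ with unity, $\mathcal{J}(R)$ denotes its Jacobson radical. $R$ is semiperfect if $R/\mathcal{J}(R)$ is Artinian and idempotents of $R/\mathcal{J}(R)$ can be lifted to $R$. The Lie algebra $L$ is of arbitrary dimension over an arbitrary field. *)

theory Defs
  imports
    "HOL-Library.Poly_Mapping"
    "HOL-Algebra.Algebra"
    "HOL-Algebra.Algebraic_Closure_Type"
begin

section \<open>Lie algebras\<close>

text \<open>
  The underlying vector space is a type \<open>'l\<close>, as in the library locale \<^locale>\<open>vector_space\<close>;
  no finiteness of dimension and no restriction on the characteristic is imposed.
\<close>

locale lie_algebra = vector_space scale
  for scale :: "'k::field \<Rightarrow> 'l::ab_group_add \<Rightarrow> 'l" +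
  fixes bracket :: "'l \<Rightarrow> 'l \<Rightarrow> 'l"
  assumes linear_bracket_right: "Vector_Spaces.linear scale scale (\<lambda>y. bracket x y)"
    and linear_bracket_left: "Vector_Spaces.linear scale scale (\<lambda>x. bracket x y)"
    and bracket_self: "bracket x x = 0"
    and jacobi: "bracket x (bracket y z) + bracket y (bracket z x) + bracket z (bracket x y) = 0"


section \<open>The universal enveloping algebra\<close>

text \<open>
  The free monoid is written additively, because the multiplication of
  \<^typ>\<open>'m \<Rightarrow>\<^sub>0 'k\<close> is convolution over an additive monoid \<open>'m\<close>.  Hence
  \<open>'l free_monoid \<Rightarrow>\<^sub>0 'k\<close> is the free associative unital \<open>'k\<close>-algebra on the set \<open>'l\<close>.
\<close>

datatype 'a free_monoid = Letters (letters: "'a list")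

instantiation free_monoid :: (type) monoid_add
begin

definition zero_free_monoid :: "'a free_monoid"
  where "0 = Letters []"

definition plus_free_monoid :: "'a free_monoid \<Rightarrow> 'a free_monoid \<Rightarrow> 'a free_monoid"
  where "u + v = Letters (letters u @ letters v)"

instance
  by standard (simp_all add: zero_free_monoid_def plus_free_monoid_def)

end

type_synonym ('l, 'k) free_algebra = "'l free_monoid \<Rightarrow>\<^sub>0 'k"

definition generator :: "'l \<Rightarrow> ('l, 'k::field) free_algebra"
  where "generator x = Poly_Mapping.single (Letters [x]) 1"

definition scalar :: "'k::field \<Rightarrow> ('l, 'k) free_algebra"
  where "scalar c = Poly_Mapping.single 0 c"

text \<open>
  The free algebra on the set \<open>'l\<close> modulo the first two families of relations is the tensor
  algebra of the vector space \<open>'l\<close>; the third family passes from there to the enveloping algebra.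
\<close>

definition enveloping_relations ::
    "('k::field \<Rightarrow> 'l::ab_group_add \<Rightarrow> 'l) \<Rightarrow> ('l \<Rightarrow> 'l \<Rightarrow> 'l) \<Rightarrow> ('l, 'k) free_algebra set"
  where "enveloping_relations scale bracket =
      {generator (x + y) - generator x - generator y | x y. True}
    \<union> {generator (scale c x) - scalar c * generator x | c x. True}
    \<union> {generator x * generator y - generator y * generator x - generator (bracket x y) | x y. True}"

definition universal_enveloping_algebra ::
    "('k::field \<Rightarrow> 'l::ab_group_add \<Rightarrow> 'l) \<Rightarrow> ('l \<Rightarrow> 'l \<Rightarrow> 'l) \<Rightarrow> ('l, 'k) free_algebra set ring"
  where "universal_enveloping_algebra scale bracket =
    ring_of_type_algebra Quot
      (Idl\<^bsub>ring_of_type_algebra\<^esub> (enveloping_relations scale bracket))"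


section \<open>Semiperfect rings\<close>

text \<open>The library notion \<^const>\<open>ideal\<close> is two-sided.\<close>

definition left_ideal :: "'a set \<Rightarrow> ('a, 'b) ring_scheme \<Rightarrow> bool"
  where "left_ideal I R \<longleftrightarrow>
    additive_subgroup I R \<and> (\<forall>r\<in>carrier R. \<forall>a\<in>I. r \<otimes>\<^bsub>R\<^esub> a \<in> I)"

definition right_ideal :: "'a set \<Rightarrow> ('a, 'b) ring_scheme \<Rightarrow> bool"
  where "right_ideal I R \<longleftrightarrow>
    additive_subgroup I R \<and> (\<forall>r\<in>carrier R. \<forall>a\<in>I. a \<otimes>\<^bsub>R\<^esub> r \<in> I)"

definition maximal_left_ideal :: "'a set \<Rightarrow> ('a, 'b) ring_scheme \<Rightarrow> bool"
  where "maximal_left_ideal M R \<longleftrightarrow>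
    left_ideal M R \<and> M \<noteq> carrier R \<and>
    (\<forall>I. left_ideal I R \<longrightarrow> M \<subseteq> I \<longrightarrow> I = M \<or> I = carrier R)"

definition jacobson_radical :: "('a, 'b) ring_scheme \<Rightarrow> 'a set"
  where "jacobson_radical R = {x \<in> carrier R. \<forall>M. maximal_left_ideal M R \<longrightarrow> x \<in> M}"

locale artinian_ring = ring +
  assumes left_dcc: "\<lbrakk>\<And>n::nat. left_ideal (I n) R; \<And>n. I (Suc n) \<subseteq> I n\<rbrakk>
      \<Longrightarrow> \<exists>n. \<forall>m\<ge>n. I m = I n"
    and right_dcc: "\<lbrakk>\<And>n::nat. right_ideal (I n) R; \<And>n. I (Suc n) \<subseteq> I n\<rbrakk>
      \<Longrightarrow> \<exists>n. \<forall>m\<ge>n. I m = I n"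

definition idempotents :: "('a, 'b) ring_scheme \<Rightarrow> 'a set"
  where "idempotents R = {e \<in> carrier R. e \<otimes>\<^bsub>R\<^esub> e = e}"

locale semiperfect_ring = ring +
  assumes artinian_quotient: "artinian_ring (R Quot jacobson_radical R)"
    and idempotents_lift: "e \<in> idempotents (R Quot jacobson_radical R)
      \<Longrightarrow> \<exists>f\<in>idempotents R. jacobson_radical R +> f = e"

end

theory Submission
  imports Defs "HOL-Library.Multiset_Order"
begin

text \<open>
  If \<open>L = 0\<close>, all generators lie in the ideal of relations, so every element of \<open>U(L)\<close> is the
  class of a scalar, hence zero or a unit, and such a ring is semiperfect.

  Conversely, let \<open>L \<noteq> 0\<close>.  The Poincare-Birkhoff-Witt theorem gives \<open>U(L)\<close> a degree that behaves
  like the degree of polynomials over a field: it is additive on products of nonzero elements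
  (so \<open>U(L)\<close> has no zero divisors), subtracting a positive-degree element from \<open>1\<close> does not change
  its degree, and a basis element \<open>x\<close> of \<open>L\<close> has degree \<open>1\<close>.  This alone excludes semiperfectness
  (\<open>not_semiperfect_if_degree\<close>).  If \<open>y \<noteq> 0\<close> were in the Jacobson radical, \<open>1 - x y\<close> would have a left
  inverse, although its degree is positive and that of \<open>1\<close> is \<open>0\<close>; so the radical vanishes.
  Then \<open>U(L)\<close> itself would be Artinian, and the chain of left ideals \<open>U(L) x\<^sup>n\<close> would stop,
  giving \<open>x\<^sup>n = u x\<^sup>n\<^sup>+\<^sup>1\<close> with too large a degree on the right.

  The degree comes from letting \<open>L\<close> act on the commutative polynomial ring \<open>S\<close> on a linearly ordered
  basis.  A basis element \<open>i\<close> sends a monomial \<open>M\<close> to \<open>i M\<close> if \<open>i\<close> is at most every letter of \<open>M\<close>.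
  Otherwise \<open>M = j N\<close> with \<open>j\<close> its least letter, \<open>j < i\<close>, and the commutation rule forces
  \<open>i \<cdot> M = j \<cdot> (i \<cdot> N) + [i, j] \<cdot> N\<close>.  In all cases \<open>i \<cdot> M\<close> is \<open>i M\<close> plus terms of degree
  at most that of \<open>M\<close>.  The work is to show that this is a representation (\<open>commutator\<close>); the
  Jacobi identity enters there.

  The free algebra then acts on \<open>S\<close>, and an element is in the ideal of relations exactly if it
  kills the polynomial \<open>1\<close> (\<open>in_relation_ideal_iff\<close>): sending a monomial to its sorted word
  inverts \<open>f \<mapsto> f \<cdot> 1\<close> modulo the relations.  The degree of \<open>f\<close> is that of \<open>f \<cdot> 1\<close>.  Since \<open>f\<close> acts
  on top-degree parts as multiplication by the top-degree part of \<open>f \<cdot> 1\<close>, and \<open>S\<close> is an integral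
  domain, degrees add (\<open>has_degree_mult\<close>).
\<close>

section \<open>Linear maps on monoid algebras\<close>

definition pm_scale :: "'k::field \<Rightarrow> ('m::monoid_add \<Rightarrow>\<^sub>0 'k) \<Rightarrow> ('m \<Rightarrow>\<^sub>0 'k)"
  where "pm_scale c v = Poly_Mapping.single 0 c * v"

global_interpretation pm: vector_space pm_scale
  by standard
    (simp_all add: pm_scale_def algebra_simps single_add mult_single flip: mult.assoc)

global_interpretation pm: vector_space_pair pm_scale pm_scale
  by standard

abbreviation pm_linear ::
    "(('m::monoid_add \<Rightarrow>\<^sub>0 'k::field) \<Rightarrow> ('n::monoid_add \<Rightarrow>\<^sub>0 'k)) \<Rightarrow> bool"
  where "pm_linear \<equiv> Vector_Spaces.linear pm_scale pm_scale"

lemma pm_linearI: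
  assumes "\<And>v w. T (v + w) = T v + T w" "\<And>c v. T (pm_scale c v) = pm_scale c (T v)"
  shows "pm_linear T"
  using assms unfolding Vector_Spaces.linear_iff by (simp add: pm.vector_space_axioms)

abbreviation mon :: "'m \<Rightarrow> ('m \<Rightarrow>\<^sub>0 'k::{zero,one})"
  where "mon m \<equiv> Poly_Mapping.single m 1"

definition lin_ext ::
    "('m \<Rightarrow> ('n::monoid_add \<Rightarrow>\<^sub>0 'k::field)) \<Rightarrow> ('m \<Rightarrow>\<^sub>0 'k) \<Rightarrow> ('n \<Rightarrow>\<^sub>0 'k)"
  where "lin_ext h v = (\<Sum>m\<in>Poly_Mapping.keys v. pm_scale (Poly_Mapping.lookup v m) (h m))"

lemma lin_ext_superset:
  assumes "finite A" "Poly_Mapping.keys v \<subseteq> A"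
  shows "lin_ext h v = (\<Sum>m\<in>A. pm_scale (Poly_Mapping.lookup v m) (h m))"
  unfolding lin_ext_def using assms
  by (intro sum.mono_neutral_left) (auto simp: in_keys_iff)

lemma lookup_pm_scale: "Poly_Mapping.lookup (pm_scale c v) m = c * Poly_Mapping.lookup v m"
  unfolding pm_scale_def
  by (simp flip: mult_map_scale_conv_mult add: map.rep_eq when_def)

lemma pm_linear_lin_ext: "pm_linear (lin_ext h)"
proof -
  have add: "lin_ext h (v + w) = lin_ext h v + lin_ext h w" for v w
    using keys_add[of v w]
      lin_ext_superset[of "Poly_Mapping.keys v \<union> Poly_Mapping.keys w" v h]
      lin_ext_superset[of "Poly_Mapping.keys v \<union> Poly_Mapping.keys w" w h]
      lin_ext_superset[of "Poly_Mapping.keys v \<union> Poly_Mapping.keys w" "v + w" h]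
    by (simp add: lookup_add pm.scale_left_distrib sum.distrib)
  have scale: "lin_ext h (pm_scale c v) = pm_scale c (lin_ext h v)" for c v
    by (subst lin_ext_superset[of "Poly_Mapping.keys v"])
      (auto simp: in_keys_iff lookup_pm_scale lin_ext_def pm.scale_sum_right)
  show ?thesis
    by (rule pm_linearI) (simp_all add: add scale)
qed

lemma lin_ext_single: "lin_ext h (Poly_Mapping.single m c) = pm_scale c (h m)"
  by (simp add: lin_ext_def)

lemma lin_ext_mon [simp]: "lin_ext h (mon m) = h m"
  by (simp add: lin_ext_single)

lemma lin_ext_cong: "(\<And>m. m \<in> Poly_Mapping.keys v \<Longrightarrow> h m = h' m) \<Longrightarrow> lin_ext h v = lin_ext h' v"
  by (simp add: lin_ext_def)

lemma in_span_mon: "v \<in> pm.span (mon ` Poly_Mapping.keys v)"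
proof -
  have "v = (\<Sum>m\<in>Poly_Mapping.keys v. pm_scale (Poly_Mapping.lookup v m) (mon m))"
  proof (rule poly_mapping_eqI)
    have "Poly_Mapping.lookup v k = (\<Sum>m\<in>Poly_Mapping.keys v. if m = k then Poly_Mapping.lookup v m else 0)" for k
      by (simp add: in_keys_iff)
    then show "Poly_Mapping.lookup v k =
        Poly_Mapping.lookup (\<Sum>m\<in>Poly_Mapping.keys v. pm_scale (Poly_Mapping.lookup v m) (mon m)) k" for k
      by (simp add: lookup_sum lookup_pm_scale lookup_single when_def if_distrib cong: if_cong)
  qed
  also have "\<dots> \<in> pm.span (mon ` Poly_Mapping.keys v)"
    by (intro pm.span_sum pm.span_scale pm.span_base) auto
  finally show ?thesis .
qed

lemma span_mon_iff: "v \<in> pm.span (mon ` A) \<longleftrightarrow> Poly_Mapping.keys v \<subseteq> A"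
proof
  assume "v \<in> pm.span (mon ` A)"
  then show "Poly_Mapping.keys v \<subseteq> A"
  proof (induction rule: pm.span_induct_alt)
    case (step c x y)
    then show ?case
      using keys_add[of "pm_scale c x" y] by (auto simp: in_keys_iff lookup_pm_scale lookup_single when_def split: if_splits)
  qed simp
next
  assume "Poly_Mapping.keys v \<subseteq> A"
  then show "v \<in> pm.span (mon ` A)"
    using in_span_mon[of v] pm.span_mono[of "mon ` Poly_Mapping.keys v" "mon ` A"] by auto
qed

lemma span_mon_UNIV: "v \<in> pm.span (range mon)"
  by (simp add: span_mon_iff)

lemma pm_linear_mult_right: "pm_linear (\<lambda>f. f * g)"
  by (rule pm_linearI) (simp_all add: pm_scale_def algebra_simps)

text \<open>
  The monoid need not be commutative, but its neutral element is central.
\<close>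

lemma single_commute: "Poly_Mapping.single 0 c * f = f * Poly_Mapping.single 0 c"
  for f :: "'m::monoid_add \<Rightarrow>\<^sub>0 'k::field"
proof (rule pm.span_induct[OF span_mon_UNIV[of f],
      where P = "\<lambda>f. Poly_Mapping.single 0 c * f = f * Poly_Mapping.single 0 c"])
  have "Poly_Mapping.single (0::'m) c * (Poly_Mapping.single 0 d * x) =
      Poly_Mapping.single 0 d * (Poly_Mapping.single 0 c * x)" for d :: 'k and x :: "'m \<Rightarrow>\<^sub>0 'k"
    by (simp add: mult_single mult.commute flip: mult.assoc)
  then show "pm.subspace {f. Poly_Mapping.single (0::'m) c * f = f * Poly_Mapping.single 0 c}"
    by (auto simp: pm.subspace_def pm_scale_def algebra_simps)
qed (auto simp: mult_single)

lemma pm_linear_mult_left: "pm_linear (\<lambda>g. f * g)"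
  by (rule pm_linearI)
    (simp_all add: pm_scale_def algebra_simps, metis mult.assoc single_commute)

lemma pm_linear_span_subset:
  assumes "pm_linear T" "pm.subspace U" "v \<in> pm.span S" "\<And>s. s \<in> S \<Longrightarrow> T s \<in> U"
  shows "T v \<in> U"
  using pm.span_minimal[OF _ pm.linear_subspace_vimage[OF assms(1,2)], of S] assms(3,4) by auto

section \<open>Lie algebras with an ordered basis\<close>

text \<open>
  The basis is indexed by a linearly ordered type, so that the multisets of indices serve as
  monomials and polynomials over them form an integral domain.  Only indices in a subset are
  used, because a basis is not a type.
\<close>

locale lie_algebra_with_basis = lie_algebra scale bracket
  for scale :: "'k::field \<Rightarrow> 'l::ab_group_add \<Rightarrow> 'l" and bracket +
  fixes e :: "'i::linorder \<Rightarrow> 'l" and index_set :: "'i set"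
  assumes inj_e: "inj_on e index_set"
    and independent_e: "independent (e ` index_set)"
    and span_e: "span (e ` index_set) = UNIV"
begin

sublocale LV: vector_space_pair scale "pm_scale :: 'k \<Rightarrow> ('i multiset \<Rightarrow>\<^sub>0 'k) \<Rightarrow> _"
  by unfold_locales

text \<open>The linear map that sends the basis vector with index \<open>i\<close> to \<open>g i\<close>.\<close>

definition ext :: "('i \<Rightarrow> ('i multiset \<Rightarrow>\<^sub>0 'k)) \<Rightarrow> 'l \<Rightarrow> ('i multiset \<Rightarrow>\<^sub>0 'k)"
  where "ext g = LV.construct (e ` index_set) (\<lambda>b. g (inv_into index_set e b))"

lemma linear_ext: "Vector_Spaces.linear scale pm_scale (ext g)"
  unfolding ext_def by (rule LV.linear_construct[OF independent_e])

lemma ext_basis [simp]: "i \<in> index_set \<Longrightarrow> ext g (e i) = g i"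
  unfolding ext_def by (subst LV.construct_basis[OF independent_e]) (auto simp: inj_e)

lemma in_span_e: "x \<in> span (e ` index_set)"
  by (simp add: span_e)

lemma ext_in_subspace:
  assumes "pm.subspace U" "\<And>i. i \<in> index_set \<Longrightarrow> g i \<in> U"
  shows "ext g x \<in> U"
proof -
  have "e ` index_set \<subseteq> ext g -` U"
    using assms(2) by auto
  then have "span (e ` index_set) \<subseteq> ext g -` U"
    by (intro span_minimal LV.linear_subspace_vimage[OF linear_ext assms(1)])
  then show ?thesis
    by (auto simp: span_e)
qed

lemma ext_cong:
  assumes "\<And>i. i \<in> index_set \<Longrightarrow> g i = g' i"
  shows "ext g = ext g'"
proof
  show "ext g x = ext g' x" for x
    by (rule LV.linear_eq_on_span[OF linear_ext linear_ext _ in_span_e]) (auto simp: assms)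
qed

lemma pm_linear_ext:
  assumes "\<And>i. pm_linear (\<lambda>v. G v i)"
  shows "pm_linear (\<lambda>v. ext (G v) x)"
proof (rule pm_linearI)
  show "ext (G (v + w)) x = ext (G v) x + ext (G w) x" for v w
    using LV.construct_add[OF independent_e, of "\<lambda>b. G v (inv_into index_set e b)" "\<lambda>b. G w (inv_into index_set e b)"]
    by (simp add: ext_def pm.linear_add[OF assms] cong: LV.construct_cong)
  show "ext (G (pm_scale c v)) x = pm_scale c (ext (G v) x)" for c v
    using LV.construct_scale[OF independent_e, of c "\<lambda>b. G v (inv_into index_set e b)"]
    by (simp add: ext_def pm.linear_scale[OF assms] cong: LV.construct_cong)
qed

section \<open>The degree filtration on polynomials\<close>

text \<open>
  The bound on the degree is strict so that \<open>deg_below 0\<close> is the zero space: a polynomial has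
  degree \<open>n\<close> exactly if it lies in \<open>deg_below (Suc n) - deg_below n\<close>, which excludes \<open>0\<close>.
\<close>

definition deg_below :: "nat \<Rightarrow> ('i multiset \<Rightarrow>\<^sub>0 'k) set"
  where "deg_below n = pm.span (mon ` {M. set_mset M \<subseteq> index_set \<and> size M < n})"

definition polys :: "('i multiset \<Rightarrow>\<^sub>0 'k) set"
  where "polys = pm.span (mon ` {M. set_mset M \<subseteq> index_set})"

lemma deg_below_iff: "v \<in> deg_below n \<longleftrightarrow> (\<forall>M\<in>Poly_Mapping.keys v. set_mset M \<subseteq> index_set \<and> size M < n)"
  unfolding deg_below_def span_mon_iff by auto

lemma polys_iff: "v \<in> polys \<longleftrightarrow> (\<forall>M\<in>Poly_Mapping.keys v. set_mset M \<subseteq> index_set)"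
  unfolding polys_def span_mon_iff by auto

lemma subspace_deg_below: "pm.subspace (deg_below n)"
  by (simp add: deg_below_def)

lemma subspace_polys: "pm.subspace polys"
  by (simp add: polys_def)

lemma deg_below_mono: "m \<le> n \<Longrightarrow> deg_below m \<subseteq> deg_below n"
  by (fastforce simp: deg_below_iff)

lemma deg_below_subset_polys: "deg_below n \<subseteq> polys"
  by (auto simp: deg_below_iff polys_iff)

lemma polys_deg_below:
  assumes "v \<in> polys"
  obtains n where "v \<in> deg_below n"
proof -
  obtain n where "\<forall>M\<in>Poly_Mapping.keys v. size M < n"
    using finite_nat_set_iff_bounded[of "size ` Poly_Mapping.keys v"] by auto
  then show ?thesis
    using that assms by (auto simp: deg_below_iff polys_iff)
qed

lemma mon_in_deg_below: "set_mset M \<subseteq> index_set \<Longrightarrow> size M < n \<Longrightarrow> mon M \<in> deg_below n"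
  by (auto simp: deg_below_iff)

lemma mult_in_deg_below:
  assumes "v \<in> deg_below m" "w \<in> deg_below n"
  shows "v * w \<in> deg_below (m + n - 1)"
  unfolding deg_below_iff
proof
  fix K assume "K \<in> Poly_Mapping.keys (v * w)"
  then obtain M N where "K = M + N" "M \<in> Poly_Mapping.keys v" "N \<in> Poly_Mapping.keys w"
    using keys_mult[of v w] by blast
  with assms show "set_mset K \<subseteq> index_set \<and> size K < m + n - 1"
    by (fastforce simp: deg_below_iff)
qed

lemma var_mult_in_deg_below: "i \<in> index_set \<Longrightarrow> v \<in> deg_below n \<Longrightarrow> mon {#i#} * v \<in> deg_below (Suc n)"
  using mult_in_deg_below[of "mon {#i#}" 2 v n] by (simp add: mon_in_deg_below)

lemma var_mult_mon: "mon {#i#} * mon M = (mon (add_mset i M) :: _ \<Rightarrow>\<^sub>0 'k)"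
  by (simp add: mult_single)

section \<open>The action on polynomials\<close>

text \<open>
  The polynomial \<open>i \<cdot> M - i M\<close>, by which the action of the basis element \<open>i\<close> on the monomial \<open>M\<close> differs
  from multiplication.  The defining equation for \<open>M = j N\<close> applies the correction of \<open>j\<close> to monomials
  that occur in the correction of \<open>i\<close> at \<open>N\<close>.  That these are smaller than \<open>M\<close> is known only
  after their degree has been bounded, so the recursion runs on a bound \<open>n\<close> for the degree of \<open>M\<close>
  instead; the value at \<open>n = 0\<close> is the right one, as it is needed for \<open>M = 1\<close> only.
\<close>

primrec correction_upto :: "nat \<Rightarrow> 'i \<Rightarrow> 'i multiset \<Rightarrow> ('i multiset \<Rightarrow>\<^sub>0 'k)" where
  "correction_upto 0 i M = 0"
| "correction_upto (Suc n) i M =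
    (if \<forall>j\<in>#M. i \<le> j then 0
     else let j = Min_mset M; N = M - {#j#} in
       mon {#j#} * correction_upto n i N + lin_ext (correction_upto n j) (correction_upto n i N)
       + ext (\<lambda>k. mon {#k#} * mon N + correction_upto n k N) (bracket (e i) (e j)))"

lemma Min_mset_add:
  assumes "\<forall>k\<in>#N. j \<le> k"
  shows "Min_mset (add_mset j N) = j"
  using assms by (intro Min_eqI) auto

lemma obtain_min_letter:
  fixes M :: "'i multiset"
  assumes "M \<noteq> {#}"
  obtains k N where "M = add_mset k N" "\<forall>l\<in>#N. k \<le> l"
proof -
  have "Min_mset M \<in># M"
    using assms by (simp add: Min_in)
  then have "M = add_mset (Min_mset M) (M - {#Min_mset M#})"
    by simp
  moreover have "\<forall>l\<in>#M - {#Min_mset M#}. Min_mset M \<le> l"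
    by (auto dest: in_diffD)
  ultimately show ?thesis by (rule that)
qed

text \<open>
  Stability in \<open>n\<close> and the degree bound are proved together: stability at \<open>M = j N\<close> concerns the
  monomials in the correction at \<open>N\<close>, and the induction hypothesis covers these only because
  the degree bound keeps them smaller than \<open>M\<close>.
\<close>

lemma correction_upto_stable:
  assumes "i \<in> index_set" "set_mset M \<subseteq> index_set" "size M \<le> n"
  shows "correction_upto n i M \<in> deg_below (Suc (size M)) \<and> correction_upto (Suc n) i M = correction_upto n i M"
  using assms
proof (induction n arbitrary: i M)
  case 0
  then show ?case by (auto simp: subspace_deg_below pm.subspace_0)
next
  case (Suc n)
  note IH = Suc.IH
  show ?case
  proof (cases "\<forall>j\<in>#M. i \<le> j")
    case True
    then show ?thesis by (auto simp: subspace_deg_below pm.subspace_0)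
  next
    case False
    define j where "j = Min_mset M"
    define N where "N = M - {#j#}"
    from False have "M \<noteq> {#}" by auto
    then have "j \<in># M" unfolding j_def by (simp add: Min_in)
    then have M: "M = add_mset j N" and j: "j \<in> index_set" and N: "set_mset N \<subseteq> index_set" "size N \<le> n"
      using Suc.prems by (auto simp: N_def size_Diff_singleton dest: in_diffD)
    have step: "correction_upto (Suc n) i M = mon {#j#} * correction_upto n i N + lin_ext (correction_upto n j) (correction_upto n i N)
       + ext (\<lambda>k. mon {#k#} * mon N + correction_upto n k N) (bracket (e i) (e j))" for n
      using False by (simp only: correction_upto.simps Let_def flip: j_def N_def) auto
    have iN: "correction_upto n i N \<in> deg_below (Suc (size N))" "correction_upto (Suc n) i N = correction_upto n i N"
      using IH[OF Suc.prems(1) N] by auto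
    have "Suc (size N) \<le> Suc n" using N by simp
    have in_keys: "correction_upto n j K \<in> deg_below (Suc (size N)) \<and> correction_upto (Suc n) j K = correction_upto n j K"
      if "K \<in> Poly_Mapping.keys (correction_upto n i N)" for K
    proof -
      have K: "set_mset K \<subseteq> index_set" "size K < Suc (size N)"
        using iN(1) that by (auto simp: deg_below_iff)
      then show ?thesis
        using IH[OF j, of K] N deg_below_mono[of "Suc (size K)" "Suc (size N)"] by auto
    qed
    have "correction_upto (Suc n) i M \<in> deg_below (Suc (size M))"
      unfolding step
    proof (intro pm.subspace_add[OF subspace_deg_below] ext_in_subspace subspace_deg_below)
      show "mon {#j#} * correction_upto n i N \<in> deg_below (Suc (size M))"
        using var_mult_in_deg_below[OF j iN(1)] by (simp add: M)
      have "lin_ext (correction_upto n j) (correction_upto n i N) \<in> deg_below (Suc (size N))"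
        unfolding lin_ext_def
        by (intro pm.subspace_sum pm.subspace_scale subspace_deg_below) (auto simp: in_keys)
      then show "lin_ext (correction_upto n j) (correction_upto n i N) \<in> deg_below (Suc (size M))"
        using deg_below_mono[of "Suc (size N)" "Suc (size M)"] by (auto simp: M)
      show "mon {#k#} * mon N \<in> deg_below (Suc (size M))" if "k \<in> index_set" for k
        using that N(1) unfolding var_mult_mon by (intro mon_in_deg_below) (auto simp: M)
      show "correction_upto n k N \<in> deg_below (Suc (size M))" if "k \<in> index_set" for k
        using IH[OF that N] deg_below_mono[of "Suc (size N)" "Suc (size M)"] by (auto simp: M)
    qed
    moreover have "correction_upto (Suc (Suc n)) i M = correction_upto (Suc n) i M"
    proof -
      have "lin_ext (correction_upto (Suc n) j) (correction_upto n i N) = lin_ext (correction_upto n j) (correction_upto n i N)"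
        using in_keys by (intro lin_ext_cong) auto
      moreover have "ext (\<lambda>k. mon {#k#} * mon N + correction_upto (Suc n) k N) = ext (\<lambda>k. mon {#k#} * mon N + correction_upto n k N)"
        using IH[OF _ N] by (intro ext_cong) simp
      ultimately show ?thesis
        by (simp only: step[of n] step[of "Suc n"] iN(2))
    qed
    ultimately show ?thesis by blast
  qed
qed

definition correction :: "'i \<Rightarrow> 'i multiset \<Rightarrow> ('i multiset \<Rightarrow>\<^sub>0 'k)"
  where "correction i M = correction_upto (size M) i M"

lemma correction_upto_eq_correction:
  assumes "i \<in> index_set" "set_mset M \<subseteq> index_set" "size M \<le> n"
  shows "correction_upto n i M = correction i M"
  using assms(3)
proof (induction n rule: dec_induct)
  case base
  then show ?case by (simp add: correction_def)
next
  case (step n)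
  then show ?case using correction_upto_stable[OF assms(1,2), of n] by simp
qed

lemma correction_in_deg_below:
  "i \<in> index_set \<Longrightarrow> set_mset M \<subseteq> index_set \<Longrightarrow> correction i M \<in> deg_below (Suc (size M))"
  using correction_upto_stable[of i M "size M"] by (simp add: correction_def)

lemma correction_eq_0: "\<forall>j\<in>#M. i \<le> j \<Longrightarrow> correction i M = 0"
  by (cases "size M") (auto simp: correction_def)

text \<open>The recursion without the auxiliary bound.\<close>

lemma correction_add_mset:
  assumes "i \<in> index_set" "j \<in> index_set" "set_mset N \<subseteq> index_set" "j < i" "\<forall>k\<in>#N. j \<le> k"
  shows "correction i (add_mset j N) =
    mon {#j#} * correction i N + lin_ext (correction j) (correction i N)
    + ext (\<lambda>k. mon {#k#} * mon N + correction k N) (bracket (e i) (e j))"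
proof -
  have "lin_ext (correction_upto (size N) j) (correction i N) = lin_ext (correction j) (correction i N)"
    using correction_in_deg_below[OF assms(1,3)] assms(2)
    by (intro lin_ext_cong correction_upto_eq_correction) (auto simp: deg_below_iff less_Suc_eq_le)
  moreover have "ext (\<lambda>k. mon {#k#} * mon N + correction_upto (size N) k N) = ext (\<lambda>k. mon {#k#} * mon N + correction k N)"
    using assms(3) by (intro ext_cong) (simp add: correction_upto_eq_correction)
  moreover have "\<not> (\<forall>k\<in>#add_mset j N. i \<le> k)"
    using assms(4) by auto
  ultimately show ?thesis
    unfolding correction_def[of i "add_mset j N"] size_add_mset correction_upto.simps Let_def
      Min_mset_add[OF assms(5)] add_mset_remove_trivial
    by (simp only: if_False flip: correction_def)
qed

definition act :: "'i \<Rightarrow> ('i multiset \<Rightarrow>\<^sub>0 'k) \<Rightarrow> ('i multiset \<Rightarrow>\<^sub>0 'k)"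
  where "act i v = mon {#i#} * v + lin_ext (correction i) v"

definition \<rho> :: "'l \<Rightarrow> ('i multiset \<Rightarrow>\<^sub>0 'k) \<Rightarrow> ('i multiset \<Rightarrow>\<^sub>0 'k)"
  where "\<rho> x v = ext (\<lambda>i. act i v) x"

lemma pm_linear_act: "pm_linear (act i)"
  unfolding act_def[abs_def]
  by (intro pm.linear_compose_add pm_linear_mult_left pm_linear_lin_ext)

lemma pm_linear_rho: "pm_linear (\<rho> x)"
  unfolding \<rho>_def[abs_def] by (intro pm_linear_ext pm_linear_act)

lemma linear_rho: "Vector_Spaces.linear scale pm_scale (\<lambda>x. \<rho> x v)"
  unfolding \<rho>_def[abs_def] by (rule linear_ext)

lemma rho_basis [simp]: "i \<in> index_set \<Longrightarrow> \<rho> (e i) v = act i v"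
  by (simp add: \<rho>_def)

text \<open>
  Modulo lower degree, a basis element acts as multiplication by its variable.  All statements
  about degrees rest on this.
\<close>

lemma act_diff_in_deg_below:
  assumes "i \<in> index_set" "v \<in> deg_below n"
  shows "act i v - mon {#i#} * v \<in> deg_below n"
proof -
  have "lin_ext (correction i) v \<in> deg_below n"
    using pm_linear_lin_ext subspace_deg_below assms(2)[unfolded deg_below_def]
  proof (rule pm_linear_span_subset)
    fix s :: "'i multiset \<Rightarrow>\<^sub>0 'k"
    assume "s \<in> mon ` {M. set_mset M \<subseteq> index_set \<and> size M < n}"
    then obtain M where "s = mon M" "set_mset M \<subseteq> index_set" "Suc (size M) \<le> n" by auto
    then show "lin_ext (correction i) s \<in> deg_below n"
      using correction_in_deg_below[OF assms(1), of M] deg_below_mono by auto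
  qed
  then show ?thesis by (simp add: act_def)
qed

lemma act_in_deg_below:
  assumes "i \<in> index_set" "v \<in> deg_below n"
  shows "act i v \<in> deg_below (Suc n)"
  using pm.subspace_add[OF subspace_deg_below var_mult_in_deg_below[OF assms], of "act i v - mon {#i#} * v"]
    act_diff_in_deg_below[OF assms] deg_below_mono[of n "Suc n"] by auto

lemma rho_in_deg_below: "v \<in> deg_below n \<Longrightarrow> \<rho> x v \<in> deg_below (Suc n)"
  unfolding \<rho>_def by (intro ext_in_subspace subspace_deg_below act_in_deg_below)

lemma rho_in_polys: "v \<in> polys \<Longrightarrow> \<rho> x v \<in> polys"
  using polys_deg_below rho_in_deg_below deg_below_subset_polys by (metis subsetD)

lemma act_min: "\<forall>j\<in>#M. i \<le> j \<Longrightarrow> act i (mon M) = mon (add_mset i M)"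
  by (simp add: act_def var_mult_mon correction_eq_0)

text \<open>
  The rule \<open>i \<cdot> (j N) = j \<cdot> (i \<cdot> N) + [i, j] \<cdot> N\<close> for which the corrections were designed.
\<close>

lemma act_rec:
  assumes "i \<in> index_set" "j \<in> index_set" "set_mset N \<subseteq> index_set" "j < i" "\<forall>k\<in>#N. j \<le> k"
  shows "act i (mon (add_mset j N)) = act j (act i (mon N)) + \<rho> (bracket (e i) (e j)) (mon N)"
proof -
  have "act j (act i (mon N)) = act j (mon (add_mset i N)) + act j (correction i N)"
    by (simp add: act_def[of i] var_mult_mon pm.linear_add[OF pm_linear_act])
  also have "act j (mon (add_mset i N)) = mon {#i#} * mon (add_mset j N)"
    using assms(4,5) by (subst act_min) (auto simp: mult_single add_mset_commute)
  finally show ?thesis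
    unfolding act_def[of i "mon (add_mset j N)"] \<rho>_def
    by (simp add: correction_add_mset[OF assms] act_def algebra_simps)
qed

section \<open>The action is a representation of the Lie algebra\<close>

lemma bracket_add_left: "bracket (x + y) z = bracket x z + bracket y z"
  and bracket_add_right: "bracket x (y + z) = bracket x y + bracket x z"
  using linear_bracket_left[of z] linear_bracket_right[of x]
  by (simp_all add: Vector_Spaces.linear_iff)

lemma bracket_anti: "bracket y x = - bracket x y"
  using bracket_self[of "x + y", unfolded bracket_add_left bracket_add_right]
  by (simp add: bracket_self eq_neg_iff_add_eq_0)

lemma bracket_minus_right: "bracket x (- y) = - bracket x y"
  using bracket_add_right[of x y "- y"] bracket_add_right[of x 0 0]
  by (simp add: eq_neg_iff_add_eq_0 add.commute)

lemma jacobi': "bracket (bracket x y) z = bracket x (bracket y z) - bracket y (bracket x z)"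
proof -
  have "bracket z (bracket x y) = - bracket (bracket x y) z"
    by (rule bracket_anti)
  moreover have "bracket y (bracket z x) = - bracket y (bracket x z)"
    by (subst bracket_anti[of z x]) (rule bracket_minus_right)
  ultimately show ?thesis
    using jacobi[of x y z] by (simp add: algebra_simps)
qed

lemma linear_eqI:
  assumes "Vector_Spaces.linear scale pm_scale S" "Vector_Spaces.linear scale pm_scale T"
    and "\<And>i. i \<in> index_set \<Longrightarrow> S (e i) = T (e i)"
  shows "S x = (T x :: 'i multiset \<Rightarrow>\<^sub>0 'k)"
  by (rule LV.linear_eq_on_span[OF assms(1,2) _ in_span_e]) (auto simp: assms(3))

lemma linear_rho_compose:
  "Vector_Spaces.linear scale scale T \<Longrightarrow> Vector_Spaces.linear scale pm_scale (\<lambda>x. \<rho> (T x) v)"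
  using Vector_Spaces.linear_compose[OF _ linear_rho, of scale T v] by (simp add: comp_def)

lemma linear_pm_compose:
  "Vector_Spaces.linear scale pm_scale S \<Longrightarrow> pm_linear T \<Longrightarrow> Vector_Spaces.linear scale pm_scale (\<lambda>x. T (S x))"
  using Vector_Spaces.linear_compose[of scale pm_scale S pm_scale T] by (simp add: comp_def)

text \<open>At a fixed polynomial \<open>v\<close>, both sides are bilinear in \<open>x\<close> and \<open>y\<close>.\<close>

lemma commutator_bilinear:
  assumes "\<And>i j. i \<in> index_set \<Longrightarrow> j \<in> index_set \<Longrightarrow> act i (act j v) - act j (act i v) = \<rho> (bracket (e i) (e j)) v"
  shows "\<rho> x (\<rho> y v) - \<rho> y (\<rho> x v) = \<rho> (bracket x y) v"
proof -
  have *: "act i (\<rho> y v) - \<rho> y (act i v) = \<rho> (bracket (e i) y) v" if "i \<in> index_set" for i y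
    by (rule linear_eqI[OF LV.linear_compose_sub[OF
          linear_pm_compose[OF linear_rho pm_linear_act] linear_rho]
        linear_rho_compose[OF linear_bracket_right]])
      (use that assms in simp)
  show ?thesis
    by (rule linear_eqI[OF LV.linear_compose_sub[OF
          linear_rho linear_pm_compose[OF linear_rho pm_linear_rho]]
        linear_rho_compose[OF linear_bracket_left]])
      (simp add: *)
qed

lemma pm_linear_commutator: "pm_linear (\<lambda>v. \<rho> x (\<rho> y v) - \<rho> y (\<rho> x v) - \<rho> (bracket x y) v)"
  using Vector_Spaces.linear_compose[OF pm_linear_rho[of y] pm_linear_rho[of x]]
   Vector_Spaces.linear_compose[OF pm_linear_rho[of x] pm_linear_rho[of y]]
  by (intro pm.linear_compose_sub pm_linear_rho) (simp_all add: comp_def)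

text \<open>
  If \<open>j < i\<close> and \<open>j\<close> is at most all letters of \<open>M\<close>, the claim is the rule \<open>act_rec\<close>, and the case with
  \<open>i\<close> and \<open>j\<close> exchanged follows by antisymmetry.  Otherwise the least letter \<open>k\<close> of \<open>M = k N\<close> is below
  both \<open>i\<close> and \<open>j\<close>.  Moving \<open>k\<close> to the front of \<open>i \<cdot> (j \<cdot> (k N))\<close> and of \<open>j \<cdot> (i \<cdot> (k N))\<close> produces
  commutators that cancel except for \<open>[i, [j, k]] - [j, [i, k]]\<close>, which is \<open>[[i, j], k]\<close> by
  the Jacobi identity.
\<close>

lemma commutator_mon:
  assumes "i \<in> index_set" "j \<in> index_set" "set_mset M \<subseteq> index_set"
  shows "act i (act j (mon M)) - act j (act i (mon M)) = \<rho> (bracket (e i) (e j)) (mon M)"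
  using assms
proof (induction "size M" arbitrary: M i j rule: less_induct)
  case less
  have IH: "\<rho> x (\<rho> y v) - \<rho> y (\<rho> x v) = \<rho> (bracket x y) v" if "v \<in> deg_below (size M)" for x y v
  proof -
    have "\<rho> x (\<rho> y v) - \<rho> y (\<rho> x v) - \<rho> (bracket x y) v \<in> {0}"
      using pm_linear_commutator pm.subspace_single_0 that[unfolded deg_below_def]
    proof (rule pm_linear_span_subset)
      fix s :: "'i multiset \<Rightarrow>\<^sub>0 'k"
      assume "s \<in> mon ` {K. set_mset K \<subseteq> index_set \<and> size K < size M}"
      then obtain K where K: "s = mon K" "set_mset K \<subseteq> index_set" "size K < size M" by auto
      show "\<rho> x (\<rho> y s) - \<rho> y (\<rho> x s) - \<rho> (bracket x y) s \<in> {0}"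
        unfolding K(1) using commutator_bilinear[OF less.hyps[OF K(3) _ _ K(2)]] by simp
    qed
    then show ?thesis by simp
  qed
  have le: "act a (act b (mon K)) - act b (act a (mon K)) = \<rho> (bracket (e a) (e b)) (mon K)"
    if "a \<in> index_set" "b \<in> index_set" "set_mset K \<subseteq> index_set" "b < a" "\<forall>k\<in>#K. b \<le> k" for a b K
    using act_rec[OF that] act_min[OF that(5)] by simp
  have flip: "act b (act a v) - act a (act b v) = \<rho> (bracket (e b) (e a)) v"
    if "act a (act b v) - act b (act a v) = \<rho> (bracket (e a) (e b)) v" for a b v
  proof -
    have "\<rho> (bracket (e b) (e a)) v = - \<rho> (bracket (e a) (e b)) v"
      unfolding bracket_anti[of "e b" "e a"] by (rule LV.linear_neg[OF linear_rho])
    then show ?thesis unfolding that[symmetric] by simp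
  qed
  consider "i = j" | "j < i" "\<forall>k\<in>#M. j \<le> k" | "i < j" "\<forall>k\<in>#M. i \<le> k"
    | "\<exists>k\<in>#M. k < i \<and> k < j"
    using linorder_less_linear[of i j] by (fastforce simp: not_le)
  then show ?case
  proof cases
    case 1
    then show ?thesis
      using LV.linear_0[OF linear_rho] by (simp add: bracket_self)
  next
    case 2
    then show ?thesis using le less.prems by blast
  next
    case 3
    then show ?thesis using flip le less.prems by blast
  next
    case 4
    from 4 have "M \<noteq> {#}" by auto
    then obtain k N where M: "M = add_mset k N" and kN: "\<forall>l\<in>#N. k \<le> l"
      by (rule obtain_min_letter)
    then have k: "k \<in> index_set" and N: "set_mset N \<subseteq> index_set" and kM: "\<forall>l\<in>#M. k \<le> l"
      using less.prems by auto
    define z :: "'i multiset \<Rightarrow>\<^sub>0 'k" where "z = mon N"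
    have ki: "k < i" and kj: "k < j" using 4 kM by auto
    have z: "z \<in> deg_below (size M)" using N by (simp add: z_def mon_in_deg_below M)
    have expand: "act a (act b (mon M)) = act k (act a (act b z)) + \<rho> (bracket (e a) (e k)) (act b z)
        + \<rho> (bracket (e b) (e k)) (act a z) + \<rho> (bracket (e a) (bracket (e b) (e k))) z"
      if ab: "a \<in> index_set" "b \<in> index_set" "k < a" "k < b" for a b
    proof -
      \<comment> \<open>\<open>b \<cdot> z\<close> has the degree of \<open>M\<close>, so the induction hypothesis does not apply to it.  Its leading
        term \<open>b N\<close> has all letters at least \<open>k\<close>, which is the case already settled.\<close>
      define w where "w = act b z - mon {#b#} * z"
      have bz: "act b z = mon (add_mset b N) + w"
        by (simp add: w_def z_def var_mult_mon)
      have "act a (act k w) - act k (act a w) = \<rho> (bracket (e a) (e k)) w"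
        using IH[of w "e a" "e k"] act_diff_in_deg_below[OF ab(2) z] ab k by (simp add: w_def)
      moreover have "act a (act k (mon (add_mset b N))) - act k (act a (mon (add_mset b N))) =
          \<rho> (bracket (e a) (e k)) (mon (add_mset b N))"
        using ab k N kN by (intro le) auto
      ultimately have "act a (act k (act b z)) - act k (act a (act b z)) = \<rho> (bracket (e a) (e k)) (act b z)"
        unfolding bz by (simp add: pm.linear_add[OF pm_linear_act] pm.linear_add[OF pm_linear_rho] algebra_simps)
      moreover have "act a (\<rho> (bracket (e b) (e k)) z) - \<rho> (bracket (e b) (e k)) (act a z) =
          \<rho> (bracket (e a) (bracket (e b) (e k))) z"
        using IH[OF z, of "e a"] ab by simp
      moreover have "act b (mon M) = act k (act b z) + \<rho> (bracket (e b) (e k)) z"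
        using act_rec[OF ab(2) k N ab(4) kN] by (simp add: M z_def)
      ultimately show ?thesis
        by (simp add: pm.linear_add[OF pm_linear_act] algebra_simps)
    qed
    have "act i (act j (mon M)) - act j (act i (mon M)) = act k (act i (act j z) - act j (act i z))
        + \<rho> (bracket (bracket (e i) (e j)) (e k)) z"
      using expand[of i j] expand[of j i] less.prems ki kj
      by (simp add: jacobi' LV.linear_diff[OF linear_rho] pm.linear_diff[OF pm_linear_act] algebra_simps)
    also have "act i (act j z) - act j (act i z) = \<rho> (bracket (e i) (e j)) z"
      using IH[OF z, of "e i" "e j"] less.prems by simp
    also have "act k (\<rho> (bracket (e i) (e j)) z) + \<rho> (bracket (bracket (e i) (e j)) (e k)) z =
        \<rho> (bracket (e i) (e j)) (act k z)"
      using IH[OF z, of "bracket (e i) (e j)" "e k"] k by (simp add: algebra_simps)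
    also have "act k z = mon M"
      using act_min[OF kN] by (simp add: z_def M)
    finally show ?thesis .
  qed
qed

lemma commutator:
  assumes "v \<in> polys"
  shows "\<rho> x (\<rho> y v) - \<rho> y (\<rho> x v) = \<rho> (bracket x y) v"
proof -
  have "\<rho> x (\<rho> y v) - \<rho> y (\<rho> x v) - \<rho> (bracket x y) v \<in> {0}"
    using pm_linear_commutator pm.subspace_single_0 assms[unfolded polys_def]
    by (rule pm_linear_span_subset) (auto simp: commutator_bilinear commutator_mon)
  then show ?thesis by simp
qed

end

section \<open>The ideal of relations is the annihilator of 1\<close>

lemma ring_ring_of_type_algebra: "ring (ring_of_type_algebra :: 'a::ring_1 ring)"
proof -
  have "\<exists>y. x + y = 0" for x :: 'a
    using add.right_inverse by blast
  then show ?thesis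
    unfolding ring_of_type_algebra_def
    by unfold_locales (auto simp: algebra_simps Units_def)
qed

lemma carrier_ring_of_type_algebra [simp]: "carrier ring_of_type_algebra = UNIV"
  by (simp add: ring_of_type_algebra_def)

lemma ideal_ring_of_type_iff:
  "ideal A (ring_of_type_algebra :: 'a::ring_1 ring) \<longleftrightarrow>
    0 \<in> A \<and> (\<forall>a\<in>A. \<forall>b\<in>A. a + b \<in> A) \<and> (\<forall>a\<in>A. \<forall>x. x * a \<in> A \<and> a * x \<in> A)"
  (is "_ \<longleftrightarrow> ?R")
proof -
  let ?T = "ring_of_type_algebra :: 'a ring"
  have T: "ring ?T"
    by (rule ring_ring_of_type_algebra)
  show ?thesis
  proof
    assume "ideal A ?T"
    then interpret ideal A ?T .
    show ?R
      using additive_subgroup.zero_closed[OF is_additive_subgroup] additive_subgroup.a_closed[OF is_additive_subgroup]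
        I_l_closed I_r_closed by (auto simp: ring_of_type_algebra_def)
  next
    assume R: ?R
    have inv: "inv\<^bsub>add_monoid ?T\<^esub> a = - a" for a
      using abelian_group.minus_equality[OF ring.is_abelian_group[OF T], of "- a" a]
      by (simp add: ring_of_type_algebra_def a_inv_def)
    then have inv: "inv\<^bsub>\<lparr>carrier = UNIV, monoid.mult = (+), one = 0\<rparr>\<^esub> a = - a" for a :: 'a
      by (simp add: ring_of_type_algebra_def)
    have "- a \<in> A" if "a \<in> A" for a
      using R that by (metis mult_minus1)
    with R show "ideal A ?T"
      by (intro idealI T group.subgroupI abelian_group.a_group ring.is_abelian_group)
        (auto simp: ring_of_type_algebra_def inv)
  qed
qed

context lie_algebra_with_basis
begin

definition relation_ideal :: "('l, 'k) free_algebra set"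
  where "relation_ideal = Idl\<^bsub>ring_of_type_algebra\<^esub> (enveloping_relations scale bracket)"

lemma ideal_relation_ideal: "ideal relation_ideal ring_of_type_algebra"
  unfolding relation_ideal_def
  by (intro ring.genideal_ideal ring_ring_of_type_algebra) simp

lemma relation_ideal_zero: "0 \<in> relation_ideal"
  and relation_ideal_add: "f \<in> relation_ideal \<Longrightarrow> g \<in> relation_ideal \<Longrightarrow> f + g \<in> relation_ideal"
  and relation_ideal_mult_left: "f \<in> relation_ideal \<Longrightarrow> g * f \<in> relation_ideal"
  and relation_ideal_mult_right: "f \<in> relation_ideal \<Longrightarrow> f * g \<in> relation_ideal"
  using ideal_relation_ideal unfolding ideal_ring_of_type_iff by auto

lemma subspace_relation_ideal: "pm.subspace relation_ideal"
  unfolding pm.subspace_def by (auto simp: relation_ideal_zero relation_ideal_add relation_ideal_mult_left pm_scale_def)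

lemma relations_in_relation_ideal: "enveloping_relations scale bracket \<subseteq> relation_ideal"
  unfolding relation_ideal_def
  by (intro ring.genideal_self ring_ring_of_type_algebra) simp

lemma generator_add_in_relation_ideal: "generator (x + y) - generator x - generator y \<in> relation_ideal"
  and generator_scale_in_relation_ideal: "generator (scale c x) - scalar c * generator x \<in> relation_ideal"
  and generator_bracket_in_relation_ideal: "generator x * generator y - generator y * generator x - generator (bracket x y) \<in> relation_ideal"
  using relations_in_relation_ideal unfolding enveloping_relations_def by blast+

lemma generator_zero_in_relation_ideal: "generator 0 \<in> relation_ideal"
  using pm.subspace_neg[OF subspace_relation_ideal generator_add_in_relation_ideal[of 0 0]] by simp

definition free_act :: "('l, 'k) free_algebra \<Rightarrow> ('i multiset \<Rightarrow>\<^sub>0 'k) \<Rightarrow> ('i multiset \<Rightarrow>\<^sub>0 'k)"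
  where "free_act f v = lin_ext (\<lambda>w. foldr \<rho> (letters w) v) f"

lemma pm_linear_free_act: "pm_linear (\<lambda>f. free_act f v)"
  unfolding free_act_def by (rule pm_linear_lin_ext)

lemma free_act_word: "free_act (mon w) v = foldr \<rho> (letters w) v"
  by (simp add: free_act_def)

lemma free_act_generator [simp]: "free_act (generator x) v = \<rho> x v"
  by (simp add: generator_def free_act_word)

lemma free_act_scalar: "free_act (scalar c) v = pm_scale c v"
  by (simp add: scalar_def free_act_def lin_ext_single zero_free_monoid_def)

lemma free_act_one [simp]: "free_act 1 v = v"
  by (simp add: free_act_word zero_free_monoid_def flip: single_one)

lemma pm_linear_foldr_rho: "pm_linear (\<lambda>v. foldr \<rho> xs v)"
proof (induction xs)
  case Nil
  then show ?case by (simp add: pm.linear_ident)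
next
  case (Cons x xs)
  then show ?case
    using Vector_Spaces.linear_compose[OF Cons pm_linear_rho[of x]] by (simp add: comp_def)
qed

lemma free_act_mult: "free_act (f * g) v = free_act f (free_act g v)"
proof (rule pm.linear_eq_on_span[of "\<lambda>f. free_act (f * g) v"])
  show "pm_linear (\<lambda>f. free_act (f * g) v)"
    using Vector_Spaces.linear_compose[OF pm_linear_mult_right[of g] pm_linear_free_act[of v]]
    by (simp add: comp_def)
  show "f \<in> pm.span (range mon)"
    by (rule span_mon_UNIV)
  fix f :: "('l, 'k) free_algebra" assume "f \<in> range mon"
  then obtain w where f: "f = mon w" by auto
  show "free_act (f * g) v = free_act f (free_act g v)"
  proof (rule pm.linear_eq_on_span[of "\<lambda>g. free_act (f * g) v" "\<lambda>g. free_act f (free_act g v)"])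
    show "pm_linear (\<lambda>g. free_act (f * g) v)"
      using Vector_Spaces.linear_compose[OF pm_linear_mult_left[of f] pm_linear_free_act[of v]]
      by (simp add: comp_def)
    show "pm_linear (\<lambda>g. free_act f (free_act g v))"
      using Vector_Spaces.linear_compose[OF pm_linear_free_act[of v] pm_linear_foldr_rho[of "letters w"]]
      by (simp add: comp_def f free_act_word)
    show "g \<in> pm.span (range mon)"
      by (rule span_mon_UNIV)
  qed (auto simp: f mult_single free_act_word plus_free_monoid_def)
qed (rule pm_linear_free_act)

lemma free_act_in_polys:
  assumes "v \<in> polys"
  shows "free_act f v \<in> polys"
  using pm_linear_free_act subspace_polys span_mon_UNIV
proof (rule pm_linear_span_subset)
  have "foldr \<rho> xs v \<in> polys" for xs
    by (induction xs) (auto simp: assms rho_in_polys)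
  then show "free_act s v \<in> polys" if "s \<in> range mon" for s
    using that by (auto simp: free_act_word)
qed

text \<open>
  The elements of the free algebra that annihilate all polynomials form a two-sided ideal, and by
  \<open>commutator\<close> it contains the relations.
\<close>

lemma free_act_relation_ideal:
  assumes "f \<in> relation_ideal" "v \<in> polys"
  shows "free_act f v = 0"
proof -
  define K where "K = {f. \<forall>v\<in>polys. free_act f v = 0}"
  note lin = pm.linear_0[OF pm_linear_free_act] pm.linear_add[OF pm_linear_free_act] pm.linear_diff[OF pm_linear_free_act]
  have act0: "free_act f 0 = 0" for f
  proof (rule pm_linear_span_subset[where T = "\<lambda>f. free_act f 0" and U = "{0}", simplified])
    show "pm_linear (\<lambda>f. free_act f 0)" "f \<in> pm.span (range mon)"
      by (rule pm_linear_free_act, rule span_mon_UNIV)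
    have "foldr \<rho> xs 0 = 0" for xs
      by (rule pm.linear_0[OF pm_linear_foldr_rho])
    then show "free_act s 0 = 0" if "s \<in> range mon" for s
      using that by (auto simp: free_act_word)
  qed
  have "ideal K ring_of_type_algebra"
    unfolding ideal_ring_of_type_iff K_def
    by (auto simp: lin free_act_mult free_act_in_polys act0)
  moreover have "enveloping_relations scale bracket \<subseteq> K"
    unfolding enveloping_relations_def K_def
    by (auto simp: lin free_act_mult free_act_scalar LV.linear_add[OF linear_rho] LV.linear_scale[OF linear_rho] commutator)
  ultimately have "relation_ideal \<subseteq> K"
    unfolding relation_ideal_def by (intro ring.genideal_minimal ring_ring_of_type_algebra)
  then show ?thesis
    using assms by (auto simp: K_def)
qed

text \<open>
  The sorted words span the free algebra modulo the relations, and the map below shows it: it turns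
  \<open>f \<cdot> 1\<close> back into a combination of sorted words that is congruent to \<open>f\<close>.
\<close>

definition sorted_word :: "'i multiset \<Rightarrow> ('l, 'k) free_algebra"
  where "sorted_word M = mon (Letters (map e (sorted_list_of_multiset M)))"

definition lift :: "('i multiset \<Rightarrow>\<^sub>0 'k) \<Rightarrow> ('l, 'k) free_algebra"
  where "lift = lin_ext sorted_word"

lemma pm_linear_lift: "pm_linear lift"
  unfolding lift_def by (rule pm_linear_lin_ext)

lemma lift_mon: "lift (mon M) = sorted_word M"
  by (simp add: lift_def)

lemma lift_add_mset:
  assumes "\<forall>j\<in>#M. i \<le> j"
  shows "lift (mon (add_mset i M)) = generator (e i) * lift (mon M)"
proof -
  have "insort i (sorted_list_of_multiset M) = i # sorted_list_of_multiset M"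
    using assms by (intro insort_is_Cons) auto
  then show ?thesis
    by (simp add: lift_mon sorted_word_def generator_def mult_single plus_free_monoid_def)
qed

text \<open>The generators depend linearly on \<open>x\<close> modulo the relations, so basis elements suffice.\<close>

lemma lift_rho_if:
  assumes "\<And>i. i \<in> index_set \<Longrightarrow> lift (act i v) - generator (e i) * lift v \<in> relation_ideal"
  shows "lift (\<rho> x v) - generator x * lift v \<in> relation_ideal"
proof (rule span_induct[OF in_span_e[of x], where P = "\<lambda>x. lift (\<rho> x v) - generator x * lift v \<in> relation_ideal"])
  show "lift (\<rho> x v) - generator x * lift v \<in> relation_ideal" if "x \<in> e ` index_set" for x
    using that assms by auto
  note lin = pm.linear_add[OF pm_linear_lift] pm.linear_scale[OF pm_linear_lift]
    LV.linear_add[OF linear_rho] LV.linear_scale[OF linear_rho]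
  have scale: "lift (\<rho> (scale c x) v) - generator (scale c x) * lift v \<in> relation_ideal"
    if "lift (\<rho> x v) - generator x * lift v \<in> relation_ideal" for c x
  proof -
    have "pm_scale c (lift (\<rho> x v) - generator x * lift v)
        - (generator (scale c x) - scalar c * generator x) * lift v \<in> relation_ideal"
      by (intro pm.subspace_diff subspace_relation_ideal pm.subspace_scale that relation_ideal_mult_right generator_scale_in_relation_ideal)
    then show ?thesis
      by (simp add: lin pm.scale_right_diff_distrib algebra_simps)
        (simp add: pm_scale_def scalar_def algebra_simps)
  qed
  have add: "lift (\<rho> (x + y) v) - generator (x + y) * lift v \<in> relation_ideal"
    if "lift (\<rho> x v) - generator x * lift v \<in> relation_ideal" "lift (\<rho> y v) - generator y * lift v \<in> relation_ideal" for x y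
  proof -
    have "(lift (\<rho> x v) - generator x * lift v) + (lift (\<rho> y v) - generator y * lift v)
        - (generator (x + y) - generator x - generator y) * lift v \<in> relation_ideal"
      by (intro pm.subspace_diff subspace_relation_ideal relation_ideal_add that relation_ideal_mult_right generator_add_in_relation_ideal)
    then show ?thesis
      by (simp add: lin algebra_simps)
  qed
  have "0 - generator 0 * lift v \<in> relation_ideal"
    by (intro pm.subspace_diff subspace_relation_ideal relation_ideal_mult_right relation_ideal_zero
        generator_zero_in_relation_ideal)
  then show "subspace {x. lift (\<rho> x v) - generator x * lift v \<in> relation_ideal}"
    unfolding subspace_def using scale add
    by (auto simp: LV.linear_0[OF linear_rho] pm.linear_0[OF pm_linear_lift])
qed

lemma pm_linear_lift_act: "pm_linear (\<lambda>v. lift (act i v) - g * lift v)"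
  using Vector_Spaces.linear_compose[OF pm_linear_act pm_linear_lift]
    Vector_Spaces.linear_compose[OF pm_linear_lift pm_linear_mult_left]
  by (intro pm.linear_compose_sub) (simp_all add: comp_def)

text \<open>
  The recursion \<open>act_rec\<close> for the action on \<open>j N\<close> is the straightening of \<open>i j N\<close> to
  \<open>j i N + [i, j] N\<close>, which is a relation of the enveloping algebra; so the map to sorted words
  respects it.
\<close>

lemma lift_act_mon:
  assumes "i \<in> index_set" "set_mset M \<subseteq> index_set"
  shows "lift (act i (mon M)) - generator (e i) * lift (mon M) \<in> relation_ideal"
  using assms
proof (induction "size M" arbitrary: M i rule: less_induct)
  case less
  have IH: "lift (act j v) - generator (e j) * lift v \<in> relation_ideal" if "j \<in> index_set" "v \<in> deg_below (size M)" for v j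
    using pm_linear_lift_act subspace_relation_ideal that(2)[unfolded deg_below_def]
    by (rule pm_linear_span_subset) (use less.hyps that(1) in auto)
  show ?case
  proof (cases "\<forall>j\<in>#M. i \<le> j")
    case True
    then show ?thesis by (simp add: act_min lift_add_mset relation_ideal_zero)
  next
    case False
    from False have "M \<noteq> {#}" by auto
    then obtain j N where M: "M = add_mset j N" and jN: "\<forall>l\<in>#N. j \<le> l"
      by (rule obtain_min_letter)
    then have j: "j \<in> index_set" and N: "set_mset N \<subseteq> index_set" and jM: "\<forall>l\<in>#M. j \<le> l"
      using less.prems by auto
    define z :: "'i multiset \<Rightarrow>\<^sub>0 'k" where "z = mon N"
    have ji: "j < i" using False jM by (meson not_le order.strict_trans1)
    have z: "z \<in> deg_below (size M)" using N by (simp add: z_def mon_in_deg_below M)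
    \<comment> \<open>The induction hypothesis covers only the part of \<open>i \<cdot> z\<close> of lower degree; on the leading
      term \<open>i N\<close> the least letter \<open>j\<close> acts by multiplication.\<close>
    define w where "w = act i z - mon {#i#} * z"
    have w: "w \<in> deg_below (size M)"
      unfolding w_def by (rule act_diff_in_deg_below[OF less.prems(1) z])
    have iz: "act i z = mon (add_mset i N) + w"
      by (simp add: w_def z_def var_mult_mon)
    have "lift (act j (mon (add_mset i N))) = generator (e j) * lift (mon (add_mset i N))"
      using jN ji by (subst act_min, simp, subst lift_add_mset) auto
    then have "lift (act j (act i z)) - generator (e j) * lift (act i z) = lift (act j w) - generator (e j) * lift w"
      unfolding iz by (simp add: pm.linear_add[OF pm_linear_act] pm.linear_add[OF pm_linear_lift] algebra_simps)
    then have 1: "lift (act j (act i z)) - generator (e j) * lift (act i z) \<in> relation_ideal"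
      using IH[OF j w] by simp
    have 2: "generator (e j) * (lift (act i z) - generator (e i) * lift z) \<in> relation_ideal"
      by (intro relation_ideal_mult_left IH less.prems z)
    have 3: "lift (\<rho> (bracket (e i) (e j)) z) - generator (bracket (e i) (e j)) * lift z \<in> relation_ideal"
      by (intro lift_rho_if IH z)
    have 4: "(generator (e i) * generator (e j) - generator (e j) * generator (e i)
        - generator (bracket (e i) (e j))) * lift z \<in> relation_ideal"
      by (intro relation_ideal_mult_right generator_bracket_in_relation_ideal)
    have "lift (act i (mon M)) = lift (act j (act i z)) + lift (\<rho> (bracket (e i) (e j)) z)"
      using act_rec[OF less.prems(1) j N ji jN]
      by (simp add: M z_def pm.linear_add[OF pm_linear_lift])
    moreover have "lift (mon M) = generator (e j) * lift z"
      using lift_add_mset[OF jN] by (simp add: M z_def)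
    ultimately show ?thesis
      using pm.subspace_diff[OF subspace_relation_ideal relation_ideal_add[OF relation_ideal_add[OF 1 2] 3] 4]
      by (simp add: algebra_simps)
  qed
qed

lemma lift_rho:
  assumes "v \<in> polys"
  shows "lift (\<rho> x v) - generator x * lift v \<in> relation_ideal"
proof (rule lift_rho_if)
  show "lift (act i v) - generator (e i) * lift v \<in> relation_ideal" if "i \<in> index_set" for i
    using pm_linear_lift_act subspace_relation_ideal assms[unfolded polys_def]
    by (rule pm_linear_span_subset) (use lift_act_mon that in auto)
qed

lemma one_in_deg_below: "1 \<in> deg_below 1"
  by (simp add: deg_below_iff)

lemma one_in_polys: "1 \<in> polys"
  by (simp add: polys_iff)

lemma lift_free_act_one: "lift (free_act f 1) - f \<in> relation_ideal"
proof (rule pm_linear_span_subset[where T = "\<lambda>f. lift (free_act f 1) - f", OF _ subspace_relation_ideal span_mon_UNIV])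
  show "pm_linear (\<lambda>f. lift (free_act f 1) - f)"
    using Vector_Spaces.linear_compose[OF pm_linear_free_act pm_linear_lift]
    by (intro pm.linear_compose_sub pm.linear_ident) (simp add: comp_def)
  have "lift (free_act (mon (Letters xs)) 1) - mon (Letters xs) \<in> relation_ideal" for xs
  proof (induction xs)
    case Nil
    show ?case
      using lift_mon[of "{#}"] by (simp add: free_act_word sorted_word_def relation_ideal_zero flip: single_one)
  next
    case (Cons x xs)
    define u where "u = free_act (mon (Letters xs)) 1"
    have "u \<in> polys" by (simp add: u_def free_act_in_polys one_in_polys)
    then have "(lift (\<rho> x u) - generator x * lift u) + generator x * (lift u - mon (Letters xs)) \<in> relation_ideal"
      using Cons by (intro relation_ideal_add lift_rho relation_ideal_mult_left) (simp_all add: u_def)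
    moreover have "generator x * mon (Letters xs) = (mon (Letters (x # xs)) :: ('l, 'k) free_algebra)"
      by (simp add: generator_def mult_single plus_free_monoid_def)
    ultimately show ?case
      by (simp add: u_def free_act_word algebra_simps)
  qed
  then have "lift (free_act (mon w) 1) - mon w \<in> relation_ideal" for w
    by (cases w) simp
  then show "lift (free_act s 1) - s \<in> relation_ideal" if "s \<in> range mon" for s
    using that by blast
qed

text \<open>
  A form of the Poincare-Birkhoff-Witt theorem: \<open>f \<mapsto> f \<cdot> 1\<close> embeds the enveloping algebra into the
  polynomials.
\<close>

lemma in_relation_ideal_iff: "f \<in> relation_ideal \<longleftrightarrow> free_act f 1 = 0"
proof
  assume "free_act f 1 = 0"
  then show "f \<in> relation_ideal"
    using pm.subspace_neg[OF subspace_relation_ideal lift_free_act_one[of f]] by (simp add: pm.linear_0[OF pm_linear_lift])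
qed (simp add: free_act_relation_ideal one_in_polys)

section \<open>The degree on the enveloping algebra\<close>

text \<open>
  A word of basis elements acts as multiplication by its monomial, up to terms of degree less
  than the sum of both degrees.
\<close>

lemma foldr_rho_diff_in_deg_below:
  assumes "set xs \<subseteq> index_set" "v \<in> deg_below (Suc n)"
  shows "foldr \<rho> (map e xs) v - mon (mset xs) * v \<in> deg_below (length xs + n)"
  using assms(1)
proof (induction xs)
  case Nil
  then show ?case by (simp add: pm.subspace_0[OF subspace_deg_below])
next
  case (Cons i xs)
  define u where "u = foldr \<rho> (map e xs) v"
  have i: "i \<in> index_set" and u: "u - mon (mset xs) * v \<in> deg_below (length xs + n)"
    using Cons by (auto simp: u_def)
  have "mon (mset xs) * v \<in> deg_below (Suc (length xs) + Suc n - 1)"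
    using Cons.prems assms(2) by (intro mult_in_deg_below mon_in_deg_below) auto
  then have "u \<in> deg_below (Suc (length xs + n))"
    using pm.subspace_add[OF subspace_deg_below, of "u - mon (mset xs) * v" "Suc (length xs + n)" "mon (mset xs) * v"]
      u deg_below_mono[of "length xs + n" "Suc (length xs + n)"] by auto
  then have "(act i u - mon {#i#} * u) + mon {#i#} * (u - mon (mset xs) * v) \<in> deg_below (Suc (length xs + n))"
    using i u by (intro pm.subspace_add subspace_deg_below act_diff_in_deg_below var_mult_in_deg_below)
  moreover have "mon {#i#} * (mon (mset xs) * v) = mon (mset (i # xs)) * v"
    by (simp add: mult_single flip: mult.assoc)
  ultimately show ?case
    using i by (simp add: right_diff_distrib flip: u_def)
qed

lemma free_act_lift_diff_in_deg_below:
  assumes "v \<in> deg_below (Suc m)" "w \<in> deg_below (Suc n)"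
  shows "free_act (lift v) w - v * w \<in> deg_below (m + n)"
proof (rule pm_linear_span_subset[OF _ subspace_deg_below assms(1)[unfolded deg_below_def]])
  show "pm_linear (\<lambda>v. free_act (lift v) w - v * w)"
    using Vector_Spaces.linear_compose[OF pm_linear_lift pm_linear_free_act]
    by (intro pm.linear_compose_sub pm_linear_mult_right) (simp add: comp_def)
  fix s :: "'i multiset \<Rightarrow>\<^sub>0 'k"
  assume "s \<in> mon ` {M. set_mset M \<subseteq> index_set \<and> size M < Suc m}"
  then obtain M where M: "s = mon M" "set_mset M \<subseteq> index_set" "size M \<le> m" by auto
  have "foldr \<rho> (map e (sorted_list_of_multiset M)) w - mon M * w \<in> deg_below (size M + n)"
    using foldr_rho_diff_in_deg_below[of "sorted_list_of_multiset M" w n] M(2) assms(2)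
    by (simp add: size_mset[symmetric] del: size_mset)
  then show "free_act (lift s) w - s * w \<in> deg_below (m + n)"
    using deg_below_mono[of "size M + n" "m + n"] M by (auto simp: lift_mon sorted_word_def free_act_word)
qed

lemma homogeneous_part:
  assumes "v \<in> deg_below (Suc n) - deg_below n"
  obtains u where "u \<noteq> 0" "\<forall>M\<in>Poly_Mapping.keys u. size M = n" "v - u \<in> deg_below n" "u \<in> deg_below (Suc n)"
proof -
  define u where "u = lin_ext (\<lambda>M. if size M = n then mon M else 0) v"
  have lookup_u: "Poly_Mapping.lookup u M = (if size M = n then Poly_Mapping.lookup v M else 0)" for M
  proof -
    have "Poly_Mapping.lookup u M = (\<Sum>N\<in>Poly_Mapping.keys v. if N = M \<and> size M = n then Poly_Mapping.lookup v N else 0)"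
      unfolding u_def lin_ext_def lookup_sum
      by (intro sum.cong) (auto simp: lookup_pm_scale lookup_single when_def)
    also have "\<dots> = (if size M = n then Poly_Mapping.lookup v M else 0)"
      by (cases "size M = n") (auto simp: in_keys_iff)
    finally show ?thesis .
  qed
  have "v - u \<in> deg_below n" "u \<in> deg_below (Suc n)"
    using assms by (auto simp: deg_below_iff in_keys_iff lookup_minus lookup_u less_Suc_eq split: if_splits)
  moreover from this have "u \<noteq> 0" using assms by auto
  moreover have "\<forall>M\<in>Poly_Mapping.keys u. size M = n"
    by (auto simp: in_keys_iff lookup_u split: if_splits)
  ultimately show ?thesis
    using that by blast
qed

text \<open>
  The degree of a product of polynomials does not drop: the product of the homogeneous parts
  of top degree is nonzero in the integral domain of polynomials, and it is homogeneous.
\<close>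

lemma mult_not_in_deg_below:
  assumes "v \<in> deg_below (Suc m) - deg_below m" "w \<in> deg_below (Suc n) - deg_below n"
  shows "v * w \<notin> deg_below (m + n)"
proof
  assume vw: "v * w \<in> deg_below (m + n)"
  obtain v' where v': "v' \<noteq> 0" "\<forall>M\<in>Poly_Mapping.keys v'. size M = m" "v - v' \<in> deg_below m" "v' \<in> deg_below (Suc m)"
    using homogeneous_part[OF assms(1)] .
  obtain w' where w': "w' \<noteq> 0" "\<forall>M\<in>Poly_Mapping.keys w'. size M = n" "w - w' \<in> deg_below n" "w' \<in> deg_below (Suc n)"
    using homogeneous_part[OF assms(2)] .
  have "(v - v') * w \<in> deg_below (m + n)" "v' * (w - w') \<in> deg_below (m + n)"
    using mult_in_deg_below[OF v'(3), of w "Suc n"] mult_in_deg_below[OF v'(4) w'(3)] assms by auto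
  then have "v * w - (v - v') * w - v' * (w - w') \<in> deg_below (m + n)"
    using vw by (intro pm.subspace_diff subspace_deg_below)
  then have "v' * w' \<in> deg_below (m + n)"
    by (simp add: algebra_simps)
  moreover have "v' * w' \<noteq> 0"
    using v' w' by simp
  then obtain K where "K \<in> Poly_Mapping.keys (v' * w')"
    by (metis keys_eq_empty equals0I)
  moreover from this have "size K = m + n"
    using keys_mult[of v' w'] v'(2) w'(2) by fastforce
  ultimately show False
    by (auto simp: deg_below_iff)
qed

definition has_degree :: "('l, 'k) free_algebra \<Rightarrow> nat \<Rightarrow> bool"
  where "has_degree f n \<longleftrightarrow> free_act f 1 \<in> deg_below (Suc n) - deg_below n"

lemma has_degree_unique:
  assumes "has_degree f m" "has_degree f n"
  shows "m = n"
proof (rule ccontr)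
  assume "m \<noteq> n"
  then have "Suc m \<le> n \<or> Suc n \<le> m" by auto
  then show False
    using assms deg_below_mono by (auto simp: has_degree_def)
qed

lemma has_degree_exists:
  assumes "f \<notin> relation_ideal"
  obtains n where "has_degree f n"
proof -
  obtain n where "free_act f 1 \<in> deg_below n"
    using polys_deg_below[OF free_act_in_polys[OF one_in_polys]] .
  moreover have "free_act f 1 \<notin> deg_below 0"
    using assms by (auto simp: in_relation_ideal_iff deg_below_iff)
  ultimately obtain k where "free_act f 1 \<notin> deg_below k" "free_act f 1 \<in> deg_below (Suc k)"
    using ex_least_nat_less[of "\<lambda>n. free_act f 1 \<in> deg_below n" n] by auto
  then show ?thesis
    using that by (auto simp: has_degree_def)
qed

lemma has_degree_not_in_relation_ideal: "has_degree f n \<Longrightarrow> f \<notin> relation_ideal"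
  using pm.subspace_0[OF subspace_deg_below] by (auto simp: in_relation_ideal_iff has_degree_def)

lemma has_degree_cong:
  assumes "f - g \<in> relation_ideal"
  shows "has_degree f n \<longleftrightarrow> has_degree g n"
proof -
  have "free_act f 1 = free_act g 1"
    using assms by (simp add: in_relation_ideal_iff pm.linear_diff[OF pm_linear_free_act])
  then show ?thesis by (simp add: has_degree_def)
qed

text \<open>
  Replacing \<open>f\<close> by the combination of sorted words for \<open>f \<cdot> 1\<close> changes it by a relation only, and
  that combination acts on \<open>g \<cdot> 1\<close> like multiplication by \<open>f \<cdot> 1\<close> up to lower degree.
\<close>

lemma has_degree_mult:
  assumes "has_degree f m" "has_degree g n"
  shows "has_degree (f * g) (m + n)"
proof -
  define v where "v = free_act f 1"
  define w where "w = free_act g 1"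
  have v: "v \<in> deg_below (Suc m) - deg_below m" and w: "w \<in> deg_below (Suc n) - deg_below n"
    using assms by (auto simp: has_degree_def v_def w_def)
  have "w \<in> polys" using w deg_below_subset_polys by auto
  then have "free_act (lift v) w = free_act f w"
    using free_act_relation_ideal[OF lift_free_act_one] by (simp add: v_def pm.linear_diff[OF pm_linear_free_act])
  then have fg: "free_act (f * g) 1 = free_act (lift v) w"
    by (simp add: free_act_mult w_def)
  have diff: "free_act (lift v) w - v * w \<in> deg_below (m + n)"
    using free_act_lift_diff_in_deg_below v w by blast
  have "v * w \<in> deg_below (Suc (m + n))"
    using mult_in_deg_below[of v "Suc m" w "Suc n"] v w by simp
  then have "free_act (lift v) w \<in> deg_below (Suc (m + n))"
    using pm.subspace_add[OF subspace_deg_below, of _ "Suc (m + n)" "v * w"] diff deg_below_mono[of "m + n" "Suc (m + n)"]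
    by (metis diff_add_cancel le_SucI order_refl subsetD)
  moreover have "free_act (lift v) w \<notin> deg_below (m + n)"
    using pm.subspace_diff[OF subspace_deg_below _ diff] mult_not_in_deg_below[OF v w] by fastforce
  ultimately show ?thesis
    by (simp add: has_degree_def fg)
qed

lemma has_degree_one_minus:
  assumes "has_degree f n" "0 < n"
  shows "has_degree (1 - f) n"
proof -
  have one: "1 \<in> deg_below n" "1 \<in> deg_below (Suc n)"
    using one_in_deg_below deg_below_mono assms(2) by (metis One_nat_def Suc_leI subsetD, metis One_nat_def Suc_le_mono le0 subsetD)
  have "free_act (1 - f) 1 = 1 - free_act f 1"
    by (simp add: pm.linear_diff[OF pm_linear_free_act])
  moreover have "1 - free_act f 1 \<in> deg_below (Suc n)"
    using assms(1) one by (intro pm.subspace_diff subspace_deg_below) (auto simp: has_degree_def)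
  moreover have "1 - free_act f 1 \<notin> deg_below n"
    using pm.subspace_diff[OF subspace_deg_below one(1), of "1 - free_act f 1"] assms(1) by (auto simp: has_degree_def)
  ultimately show ?thesis
    by (simp add: has_degree_def)
qed

lemma has_degree_generator:
  assumes "i \<in> index_set"
  shows "has_degree (generator (e i)) 1"
proof -
  have "free_act (generator (e i)) 1 = mon {#i#}"
    using act_min[of "{#}" i] assms by (simp flip: single_one)
  then show ?thesis
    using assms by (simp add: has_degree_def deg_below_iff)
qed

end

section \<open>Left ideals and the Jacobson radical\<close>

context ring
begin

lemma additive_subgroupI':
  assumes "I \<subseteq> carrier R" "\<zero> \<in> I" "\<And>a b. a \<in> I \<Longrightarrow> b \<in> I \<Longrightarrow> a \<oplus> b \<in> I" "\<And>a. a \<in> I \<Longrightarrow> \<ominus> a \<in> I"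
  shows "additive_subgroup I R"
  using assms by (intro additive_subgroup.intro add.subgroupI) (auto simp: a_inv_def)

lemma carrier_quot_obtain:
  assumes "c \<in> carrier (R Quot I)"
  obtains a where "a \<in> carrier R" "c = I +> a"
proof -
  have "c \<in> (\<Union>a\<in>carrier R. {I +> a})"
    using assms by (simp only: FactRing_def A_RCOSETS_def' partial_object.simps)
  then show ?thesis using that by blast
qed

lemma left_ideal_iff:
  "left_ideal I R \<longleftrightarrow> I \<subseteq> carrier R \<and> \<zero> \<in> I \<and> (\<forall>a\<in>I. \<forall>b\<in>I. a \<oplus> b \<in> I)
    \<and> (\<forall>r\<in>carrier R. \<forall>a\<in>I. r \<otimes> a \<in> I)"
proof -
  have "\<ominus> a \<in> I" if "I \<subseteq> carrier R" "\<forall>r\<in>carrier R. \<forall>a\<in>I. r \<otimes> a \<in> I" "a \<in> I" for a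
    using that l_minus[of \<one> a] by (metis a_inv_closed l_one one_closed subsetD)
  then show ?thesis
    unfolding left_ideal_def
    by (auto intro!: additive_subgroupI' dest: additive_subgroup.a_subset additive_subgroup.zero_closed
        additive_subgroup.a_closed)
qed

lemma left_ideal_principal:
  assumes "b \<in> carrier R"
  shows "left_ideal {r \<otimes> b | r. r \<in> carrier R} R"
  unfolding left_ideal_iff
proof (intro conjI ballI)
  show "{r \<otimes> b | r. r \<in> carrier R} \<subseteq> carrier R"
    using assms by auto
  show "\<zero> \<in> {r \<otimes> b | r. r \<in> carrier R}"
    using assms by (auto intro: exI[of _ \<zero>])
  show "a \<oplus> a' \<in> {r \<otimes> b | r. r \<in> carrier R}"
    if "a \<in> {r \<otimes> b | r. r \<in> carrier R}" "a' \<in> {r \<otimes> b | r. r \<in> carrier R}" for a a'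
    using that assms by (auto simp flip: l_distr)
  show "s \<otimes> a \<in> {r \<otimes> b | r. r \<in> carrier R}"
    if "s \<in> carrier R" "a \<in> {r \<otimes> b | r. r \<in> carrier R}" for s a
    using that assms by (auto simp flip: m_assoc)
qed

lemma left_ideal_eq_carrier: "left_ideal I R \<Longrightarrow> \<one> \<in> I \<Longrightarrow> I = carrier R"
  unfolding left_ideal_iff using r_one by (metis subsetI subset_antisym)

lemma exists_maximal_left_ideal:
  assumes "left_ideal I R" "\<one> \<notin> I"
  obtains M where "maximal_left_ideal M R" "I \<subseteq> M"
proof -
  define A where "A = {K. left_ideal K R \<and> I \<subseteq> K \<and> \<one> \<notin> K}"
  have "\<exists>M\<in>A. \<forall>K\<in>A. M \<subseteq> K \<longrightarrow> K = M"
  proof (rule subset_Zorn_nonempty)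
    show "A \<noteq> {}" using assms by (auto simp: A_def)
    fix C assume C: "C \<noteq> {}" "subset.chain A C"
    then have CA: "C \<subseteq> A" and total: "\<And>S T. S \<in> C \<Longrightarrow> T \<in> C \<Longrightarrow> S \<subseteq> T \<or> T \<subseteq> S"
      by (auto simp: subset_chain_def)
    have ideal: "\<And>S. S \<in> C \<Longrightarrow> left_ideal S R" using CA by (auto simp: A_def)
    have "a \<oplus> b \<in> \<Union>C" if ab: "a \<in> \<Union>C" "b \<in> \<Union>C" for a b
    proof -
      obtain S where "S \<in> C" "a \<in> S" "b \<in> S"
        using ab total by blast
      then show ?thesis using ideal[of S] by (auto simp: left_ideal_iff)
    qed
    moreover have "\<Union>C \<subseteq> carrier R" "r \<in> carrier R \<Longrightarrow> a \<in> \<Union>C \<Longrightarrow> r \<otimes> a \<in> \<Union>C" for r a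
      using ideal[unfolded left_ideal_iff] by blast+
    moreover have "\<zero> \<in> \<Union>C"
      using ideal C(1) by (auto simp: left_ideal_iff)
    ultimately have "left_ideal (\<Union>C) R"
      unfolding left_ideal_iff by simp
    then show "\<Union>C \<in> A"
      using CA C(1) by (auto simp: A_def)
  qed
  then obtain M where M: "M \<in> A" "\<And>K. K \<in> A \<Longrightarrow> M \<subseteq> K \<Longrightarrow> K = M" by blast
  have "maximal_left_ideal M R"
    unfolding maximal_left_ideal_def
  proof (intro conjI allI impI)
    show "left_ideal M R" "M \<noteq> carrier R" using M(1) by (auto simp: A_def)
    show "K = M \<or> K = carrier R" if K: "left_ideal K R" "M \<subseteq> K" for K
      using M K left_ideal_eq_carrier[of K] by (auto simp: A_def)
  qed
  moreover have "I \<subseteq> M" using M(1) by (auto simp: A_def)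
  ultimately show ?thesis by (rule that)
qed

lemma zero_in_jacobson_radical: "\<zero> \<in> jacobson_radical R"
  by (auto simp: jacobson_radical_def maximal_left_ideal_def left_ideal_iff)

text \<open>
  Without a left inverse, \<open>1 - a y\<close> lies in a maximal left ideal.  That ideal also contains \<open>y\<close>,
  hence \<open>1\<close>.
\<close>

lemma jacobson_radical_left_inverse:
  assumes "y \<in> jacobson_radical R" "a \<in> carrier R"
  obtains z where "z \<in> carrier R" "z \<otimes> (\<one> \<ominus> a \<otimes> y) = \<one>"
proof (rule ccontr)
  assume "\<not> thesis"
  have y: "y \<in> carrier R" using assms(1) by (simp add: jacobson_radical_def)
  define c where "c = \<one> \<ominus> a \<otimes> y"
  have c: "c \<in> carrier R" using y assms(2) by (simp add: c_def)
  have "\<one> \<notin> {r \<otimes> c | r. r \<in> carrier R}"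
  proof
    assume "\<one> \<in> {r \<otimes> c | r. r \<in> carrier R}"
    then obtain z where "z \<in> carrier R" "z \<otimes> c = \<one>" by auto
    then show False using that \<open>\<not> thesis\<close> unfolding c_def by blast
  qed
  then obtain M where M: "maximal_left_ideal M R" "{r \<otimes> c | r. r \<in> carrier R} \<subseteq> M"
    using exists_maximal_left_ideal[OF left_ideal_principal[OF c]] by blast
  have "\<one> \<otimes> c \<in> M" using M(2) by blast
  then have "c \<in> M" using c by simp
  moreover have "y \<in> M" using assms(1) M(1) by (simp add: jacobson_radical_def)
  moreover have left: "left_ideal M R" "M \<noteq> carrier R" using M(1) by (auto simp: maximal_left_ideal_def)
  ultimately have "c \<oplus> a \<otimes> y \<in> M"
    using assms(2) by (auto simp: left_ideal_iff)
  also have "c \<oplus> a \<otimes> y = \<one>"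
    using y assms(2) by (simp add: c_def a_minus_def a_assoc l_neg)
  finally show False
    using left left_ideal_eq_carrier by blast
qed

lemma quot_zero_inj:
  assumes "a \<in> carrier R" "b \<in> carrier R" "{\<zero>} +> a = {\<zero>} +> b"
  shows "a = b"
  using quotient_eq_iff_same_a_r_cos[OF zeroideal assms(1,2)] assms by simp

end

section \<open>Semiperfect rings\<close>

text \<open>The left ideals generated by the powers of \<open>b\<close> decrease.\<close>

lemma (in artinian_ring) power_in_left_ideal_of_next_power:
  assumes b: "b \<in> carrier R"
  obtains n :: nat and u where "u \<in> carrier R" "b [^] n = u \<otimes> b [^] Suc n"
proof -
  define I where "I n = {r \<otimes> b [^] n | r. r \<in> carrier R}" for n :: nat
  have "I (Suc n) \<subseteq> I n" for n
  proof
    fix a assume "a \<in> I (Suc n)"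
    then obtain r where "r \<in> carrier R" "a = r \<otimes> b [^] Suc n" by (auto simp: I_def)
    then have "a = (r \<otimes> b) \<otimes> b [^] n" "r \<otimes> b \<in> carrier R"
      using b nat_pow_Suc2[OF b, of n] by (simp_all add: m_assoc del: nat_pow_Suc)
    then show "a \<in> I n" by (auto simp: I_def)
  qed
  moreover have "left_ideal (I n) R" for n
    unfolding I_def using b by (intro left_ideal_principal) simp
  ultimately obtain n where "I (Suc n) = I n"
    using left_dcc[of I] by (metis le_SucI order_refl)
  moreover have "b [^] n \<in> I n"
    using b by (auto simp: I_def intro!: exI[of _ \<one>])
  ultimately have "b [^] n \<in> I (Suc n)" by simp
  then show ?thesis using that by (auto simp: I_def)
qed

text \<open>
  Left inverses of \<open>1 - x y\<close> cannot exist for degree reasons unless \<open>y = 0\<close>, so the Jacobson radical is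
  zero.  The ring is then Artinian itself, whereas \<open>x\<^sup>n = v x\<^sup>n\<^sup>+\<^sup>1\<close> contradicts additivity of degrees.
\<close>

lemma (in ring) not_semiperfect_if_degree:
  fixes deg :: "'a \<Rightarrow> nat"
  assumes mult: "\<And>a b. \<lbrakk>a \<in> carrier R; b \<in> carrier R; a \<noteq> \<zero>; b \<noteq> \<zero>\<rbrakk>
      \<Longrightarrow> a \<otimes> b \<noteq> \<zero> \<and> deg (a \<otimes> b) = deg a + deg b"
    and one_minus: "\<And>a. \<lbrakk>a \<in> carrier R; a \<noteq> \<zero>; 0 < deg a\<rbrakk> \<Longrightarrow> \<one> \<ominus> a \<noteq> \<zero> \<and> deg (\<one> \<ominus> a) = deg a"
    and x: "x \<in> carrier R" "x \<noteq> \<zero>" "0 < deg x"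
  shows "\<not> semiperfect_ring R"
proof
  assume "semiperfect_ring R"
  then interpret semiperfect_ring R .
  have "\<one> \<noteq> \<zero>"
    using x by (metis r_one r_null)
  then have one: "\<one> \<noteq> \<zero>" "deg \<one> = 0"
    using x mult[of x \<one>] by auto
  have "y = \<zero>" if y: "y \<in> jacobson_radical R" for y
  proof (rule ccontr)
    assume "y \<noteq> \<zero>"
    have yc: "y \<in> carrier R" using y by (simp add: jacobson_radical_def)
    obtain z where z: "z \<in> carrier R" "z \<otimes> (\<one> \<ominus> x \<otimes> y) = \<one>"
      using jacobson_radical_left_inverse[OF y x(1)] .
    have "x \<otimes> y \<noteq> \<zero>" "0 < deg (x \<otimes> y)"
      using mult[of x y] x yc \<open>y \<noteq> \<zero>\<close> by auto
    then have "\<one> \<ominus> x \<otimes> y \<noteq> \<zero>" "0 < deg (\<one> \<ominus> x \<otimes> y)"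
      using one_minus[of "x \<otimes> y"] x yc by auto
    moreover have "z \<noteq> \<zero>" using z one x yc by auto
    ultimately show False
      using mult[of z "\<one> \<ominus> x \<otimes> y"] z one x yc by auto
  qed
  then have J: "jacobson_radical R = {\<zero>}"
    using zero_in_jacobson_radical by blast
  interpret Q: artinian_ring "R Quot {\<zero>}"
    using artinian_quotient by (simp add: J)
  interpret q: ring_hom_ring R "R Quot {\<zero>}" "(+>) {\<zero>}"
    by (rule ideal.rcos_ring_hom_ring[OF zeroideal])
  obtain n u where u: "u \<in> carrier (R Quot {\<zero>})"
      "({\<zero>} +> x) [^]\<^bsub>R Quot {\<zero>}\<^esub> n = u \<otimes>\<^bsub>R Quot {\<zero>}\<^esub> ({\<zero>} +> x) [^]\<^bsub>R Quot {\<zero>}\<^esub> Suc n"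
    using Q.power_in_left_ideal_of_next_power[OF q.hom_closed[OF x(1)]] .
  obtain v where v: "v \<in> carrier R" "u = {\<zero>} +> v"
    using carrier_quot_obtain[OF u(1)] .
  have "{\<zero>} +> (x [^] n) = {\<zero>} +> (v \<otimes> x [^] Suc n)"
    using u(2) v x(1) by (simp add: q.hom_nat_pow del: nat_pow_Suc Q.nat_pow_Suc)
  then have eq: "x [^] n = v \<otimes> x [^] Suc n"
    using v x(1) by (intro quot_zero_inj) auto
  have pow: "x [^] k \<noteq> \<zero> \<and> deg (x [^] k) = k * deg x" for k :: nat
    by (induction k) (use one x mult in auto)
  have "v \<noteq> \<zero>" using eq pow[of n] x(1) by auto
  then have "deg (v \<otimes> x [^] Suc n) = deg v + Suc n * deg x"
    using mult[of v "x [^] Suc n"] v x(1) pow[of "Suc n"] by simp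
  with eq pow[of n] x(3) show False by simp
qed

text \<open>
  The hypothesis below, every element being zero or a unit, admits the zero ring besides
  division rings; so the results apply before a quotient is known to be nontrivial.
\<close>

lemma (in ring) ideal_of_division_ring:
  assumes "\<And>a. a \<in> carrier R \<Longrightarrow> a = \<zero> \<or> a \<in> Units R" "left_ideal I R \<or> right_ideal I R"
  shows "I = {\<zero>} \<or> I = carrier R"
proof -
  have I: "additive_subgroup I R"
    using assms(2) by (auto simp: left_ideal_def right_ideal_def)
  have sub: "I \<subseteq> carrier R" "\<zero> \<in> I"
    using additive_subgroup.a_subset[OF I] additive_subgroup.zero_closed[OF I] by auto
  show ?thesis
  proof (cases "I = {\<zero>}")
    case False
    then obtain a where a: "a \<in> I" "a \<in> Units R"
      using assms(1) sub by blast
    have "r \<in> I" if r: "r \<in> carrier R" for r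
      using assms(2)
    proof
      assume "left_ideal I R"
      then have "(r \<otimes> inv a) \<otimes> a \<in> I"
        using a r Units_inv_closed by (simp add: left_ideal_def)
      also have "(r \<otimes> inv a) \<otimes> a = r"
        using a r by (simp add: m_assoc Units_closed)
      finally show ?thesis .
    next
      assume "right_ideal I R"
      then have "a \<otimes> (inv a \<otimes> r) \<in> I"
        using a r Units_inv_closed by (simp add: right_ideal_def)
      also have "a \<otimes> (inv a \<otimes> r) = r"
        using a r by (simp add: Units_closed flip: m_assoc)
      finally show ?thesis .
    qed
    then show ?thesis using sub by blast
  qed simp
qed

lemma (in ring) artinian_if_division_ring:
  assumes "\<And>a. a \<in> carrier R \<Longrightarrow> a = \<zero> \<or> a \<in> Units R"
  shows "artinian_ring R"
proof -
  have stable: "\<exists>n. \<forall>m\<ge>n. I m = I n"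
    if I: "\<And>n. left_ideal (I n) R \<or> right_ideal (I n) R" "\<And>n. I (Suc n) \<subseteq> I n" for I :: "nat \<Rightarrow> 'a set"
  proof (cases "\<exists>n. I n = {\<zero>}")
    case True
    then obtain n where n: "I n = {\<zero>}" by blast
    have "I m = {\<zero>}" if "n \<le> m" for m
      using lift_Suc_antimono_le[of I, OF I(2) that] n I(1)[of m]
      by (auto simp: left_ideal_def right_ideal_def dest: additive_subgroup.zero_closed)
    then show ?thesis using n by metis
  next
    case False
    then have "\<And>n. I n = carrier R"
      using ideal_of_division_ring[OF assms I(1)] by blast
    then show ?thesis by simp
  qed
  show ?thesis
    by (intro artinian_ring.intro ring_axioms artinian_ring_axioms.intro) (auto intro: stable)
qed

lemma (in ring) semiperfect_if_division_ring:
  assumes "\<And>a. a \<in> carrier R \<Longrightarrow> a = \<zero> \<or> a \<in> Units R"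
  shows "semiperfect_ring R"
proof -
  have zero_ideal: "left_ideal {\<zero>} R"
    by (auto simp: left_ideal_iff)
  have J: "jacobson_radical R = {\<zero>}"
  proof (cases "carrier R = {\<zero>}")
    case True
    then show ?thesis using zero_in_jacobson_radical by (auto simp: jacobson_radical_def)
  next
    case False
    then have "maximal_left_ideal {\<zero>} R"
      unfolding maximal_left_ideal_def using zero_ideal ideal_of_division_ring[OF assms] by blast
    then show ?thesis using zero_in_jacobson_radical by (auto simp: jacobson_radical_def)
  qed
  interpret q: ring_hom_ring R "R Quot {\<zero>}" "(+>) {\<zero>}"
    by (rule ideal.rcos_ring_hom_ring[OF zeroideal])
  have surj: "\<exists>a\<in>carrier R. c = {\<zero>} +> a" if "c \<in> carrier (R Quot {\<zero>})" for c
    using carrier_quot_obtain[OF that] by blast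
  have "artinian_ring (R Quot {\<zero>})"
  proof (rule q.S.artinian_if_division_ring)
    fix c assume "c \<in> carrier (R Quot {\<zero>})"
    then obtain a where a: "a \<in> carrier R" "c = {\<zero>} +> a" using surj by blast
    from assms[OF a(1)] show "c = \<zero>\<^bsub>R Quot {\<zero>}\<^esub> \<or> c \<in> Units (R Quot {\<zero>})"
    proof
      assume "a = \<zero>"
      then show ?thesis using a q.hom_zero by simp
    next
      assume u: "a \<in> Units R"
      then have "({\<zero>} +> inv a) \<otimes>\<^bsub>R Quot {\<zero>}\<^esub> c = \<one>\<^bsub>R Quot {\<zero>}\<^esub>"
          "c \<otimes>\<^bsub>R Quot {\<zero>}\<^esub> ({\<zero>} +> inv a) = \<one>\<^bsub>R Quot {\<zero>}\<^esub>"
        using a q.hom_mult[of "inv a" a] q.hom_mult[of a "inv a"] q.hom_one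
        by (simp_all add: Units_l_inv Units_r_inv)
      moreover have "{\<zero>} +> inv a \<in> carrier (R Quot {\<zero>})" "c \<in> carrier (R Quot {\<zero>})"
        using u a q.hom_closed Units_inv_closed by auto
      ultimately show ?thesis
        unfolding Units_def by blast
    qed
  qed
  moreover have "\<exists>f\<in>idempotents R. {\<zero>} +> f = c" if c: "c \<in> idempotents (R Quot {\<zero>})" for c
  proof -
    obtain a where a: "a \<in> carrier R" "c = {\<zero>} +> a"
      using c surj by (auto simp: idempotents_def)
    then have "{\<zero>} +> (a \<otimes> a) = {\<zero>} +> a"
      using c q.hom_mult[of a a] by (auto simp: idempotents_def)
    then have "a \<otimes> a = a"
      using a(1) by (intro quot_zero_inj) auto
    then show ?thesis using a by (auto simp: idempotents_def)
  qed
  ultimately show ?thesis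
    by (intro semiperfect_ring.intro ring_axioms semiperfect_ring_axioms.intro) (simp_all add: J)
qed

section \<open>A linear order on an arbitrary type\<close>

text \<open>
  A copy of \<open>'a\<close> ordered by some well-order, which exists by the axiom of choice.  It indexes
  the basis of a Lie algebra whose elements carry no order.
\<close>

datatype 'a well_ordered = Well_Ordered (underlying: 'a)

instantiation well_ordered :: (type) linorder
begin

definition less_eq_well_ordered :: "'a well_ordered \<Rightarrow> 'a well_ordered \<Rightarrow> bool"
  where "x \<le> y \<longleftrightarrow> (underlying x, underlying y) \<in> (SOME r. Well_order r \<and> Field r = UNIV)"

definition less_well_ordered :: "'a well_ordered \<Rightarrow> 'a well_ordered \<Rightarrow> bool"
  where "x < y \<longleftrightarrow> x \<le> y \<and> x \<noteq> (y :: 'a well_ordered)"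

instance
proof -
  define r :: "'a rel" where "r = (SOME r. Well_order r \<and> Field r = UNIV)"
  have "Well_order r \<and> Field r = UNIV"
    unfolding r_def by (rule someI_ex) (rule Zorn.well_ordering)
  then have r: "refl r" "antisym r" "trans r" "total r"
    by (auto simp: order_on_defs)
  have le: "x \<le> y \<longleftrightarrow> (underlying x, underlying y) \<in> r" for x y :: "'a well_ordered"
    by (simp add: less_eq_well_ordered_def r_def)
  have refl: "x \<le> x" for x :: "'a well_ordered"
    using r(1) by (simp add: le refl_on_def)
  have antisym: "x \<le> y \<Longrightarrow> y \<le> x \<Longrightarrow> x = y" for x y :: "'a well_ordered"
    using r(2) by (auto simp: le antisym_def intro: well_ordered.expand)
  have total: "x \<le> y \<or> y \<le> x" for x y :: "'a well_ordered"
    using r(4) refl[of x] by (cases "x = y") (auto simp: le total_on_def dest: well_ordered.expand)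
  have trans: "x \<le> y \<Longrightarrow> y \<le> z \<Longrightarrow> x \<le> z" for x y z :: "'a well_ordered"
    using r(3) by (auto simp: le dest: transD)
  show "OFCLASS('a well_ordered, linorder_class)"
    by standard (use refl antisym total trans in \<open>auto simp: less_well_ordered_def\<close>)
qed

end

section \<open>Semiperfect enveloping algebras\<close>

context lie_algebra_with_basis
begin

abbreviation free_ring where
  "free_ring \<equiv> (ring_of_type_algebra :: ('l, 'k) free_algebra ring)"

abbreviation envelope where
  "envelope \<equiv> free_ring Quot relation_ideal"

abbreviation coset where
  "coset \<equiv> (+>\<^bsub>free_ring\<^esub>) relation_ideal"

lemma universal_enveloping_algebra_eq: "universal_enveloping_algebra scale bracket = envelope"
  by (simp add: universal_enveloping_algebra_def relation_ideal_def)

lemma a_minus_free_ring [simp]: "f \<ominus>\<^bsub>free_ring\<^esub> g = f - g"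
proof -
  interpret free_ring: ring free_ring by (rule ring_ring_of_type_algebra)
  have "\<ominus>\<^bsub>free_ring\<^esub> g = - g"
    by (rule free_ring.minus_equality) (simp_all add: ring_of_type_algebra_def)
  then show ?thesis
    by (simp add: a_minus_def) (simp add: ring_of_type_algebra_def)
qed

lemma coset_eq_iff: "coset f = coset g \<longleftrightarrow> f - g \<in> relation_ideal"
  using ring.quotient_eq_iff_same_a_r_cos[OF ring_ring_of_type_algebra ideal_relation_ideal, of f g] by simp

lemma coset_ring_hom: "ring_hom_ring free_ring envelope coset"
  by (rule ideal.rcos_ring_hom_ring[OF ideal_relation_ideal])

lemma coset_mult: "coset f \<otimes>\<^bsub>envelope\<^esub> coset g = coset (f * g)"
  and coset_zero: "\<zero>\<^bsub>envelope\<^esub> = coset 0"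
  and coset_one: "\<one>\<^bsub>envelope\<^esub> = coset 1"
proof -
  interpret q: ring_hom_ring free_ring envelope coset
    by (rule coset_ring_hom)
  show "coset f \<otimes>\<^bsub>envelope\<^esub> coset g = coset (f * g)"
    using q.hom_mult[of f g] by (simp add: ring_of_type_algebra_def)
  show "\<zero>\<^bsub>envelope\<^esub> = coset 0"
    using q.hom_zero by (simp add: ring_of_type_algebra_def)
  show "\<one>\<^bsub>envelope\<^esub> = coset 1"
    using q.hom_one by (simp add: ring_of_type_algebra_def)
qed

lemma not_semiperfect_envelope:
  assumes "index_set \<noteq> {}"
  shows "\<not> semiperfect_ring envelope"
proof -
  interpret q: ring_hom_ring free_ring envelope coset
    by (rule coset_ring_hom)
  have one_minus: "\<one>\<^bsub>envelope\<^esub> \<ominus>\<^bsub>envelope\<^esub> coset f = coset (1 - f)" for f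
  proof -
    have "coset (\<one>\<^bsub>free_ring\<^esub> \<ominus>\<^bsub>free_ring\<^esub> f) = \<one>\<^bsub>envelope\<^esub> \<ominus>\<^bsub>envelope\<^esub> coset f"
      unfolding a_minus_def by (subst q.hom_add) (simp_all del: a_minus_free_ring)
    then show ?thesis
      by simp (simp add: ring_of_type_algebra_def)
  qed
  have ne_zero: "coset f \<noteq> \<zero>\<^bsub>envelope\<^esub> \<longleftrightarrow> f \<notin> relation_ideal" for f
    by (simp add: coset_zero coset_eq_iff)
  \<comment> \<open>The class of \<open>0\<close> has no degree; \<open>deg\<close> is arbitrary there.\<close>
  define deg where "deg c = (THE n. \<exists>f. c = coset f \<and> has_degree f n)" for c
  have deg: "deg (coset f) = n" if "has_degree f n" for f n
    unfolding deg_def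
  proof (rule the_equality)
    show "\<exists>g. coset f = coset g \<and> has_degree g n" using that by blast
    show "m = n" if m: "\<exists>g. coset f = coset g \<and> has_degree g m" for m
      using m \<open>has_degree f n\<close> has_degree_cong has_degree_unique by (metis coset_eq_iff)
  qed
  have coset: "\<exists>f. c = coset f" if "c \<in> carrier envelope" for c
    using q.R.carrier_quot_obtain[OF that] by blast
  have elem: "\<exists>f. c = coset f \<and> has_degree f (deg c)"
    if "c \<in> carrier envelope" "c \<noteq> \<zero>\<^bsub>envelope\<^esub>" for c
    using coset[OF that(1)] that(2) ne_zero has_degree_exists deg by metis
  obtain i where i: "i \<in> index_set" using assms by blast
  note gen = has_degree_generator[OF i]
  show ?thesis
  proof (rule q.S.not_semiperfect_if_degree)
    fix c d
    assume "c \<in> carrier envelope" "d \<in> carrier envelope" "c \<noteq> \<zero>\<^bsub>envelope\<^esub>" "d \<noteq> \<zero>\<^bsub>envelope\<^esub>"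
    then obtain f g where c: "c = coset f" "has_degree f (deg c)" and d: "d = coset g" "has_degree g (deg d)"
      using elem by meson
    have fg: "has_degree (f * g) (deg c + deg d)"
      by (rule has_degree_mult[OF c(2) d(2)])
    have cd: "c \<otimes>\<^bsub>envelope\<^esub> d = coset (f * g)"
      by (subst c(1), subst d(1), rule coset_mult)
    show "c \<otimes>\<^bsub>envelope\<^esub> d \<noteq> \<zero>\<^bsub>envelope\<^esub> \<and> deg (c \<otimes>\<^bsub>envelope\<^esub> d) = deg c + deg d"
      unfolding cd deg[OF fg] using has_degree_not_in_relation_ideal[OF fg] ne_zero by blast
  next
    fix c
    assume "c \<in> carrier envelope" "c \<noteq> \<zero>\<^bsub>envelope\<^esub>" "0 < deg c"
    then obtain f where c: "c = coset f" "has_degree f (deg c)"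
      using elem by meson
    have f: "has_degree (1 - f) (deg c)"
      by (rule has_degree_one_minus[OF c(2) \<open>0 < deg c\<close>])
    have c': "\<one>\<^bsub>envelope\<^esub> \<ominus>\<^bsub>envelope\<^esub> c = coset (1 - f)"
      by (subst c(1), rule one_minus)
    show "\<one>\<^bsub>envelope\<^esub> \<ominus>\<^bsub>envelope\<^esub> c \<noteq> \<zero>\<^bsub>envelope\<^esub> \<and> deg (\<one>\<^bsub>envelope\<^esub> \<ominus>\<^bsub>envelope\<^esub> c) = deg c"
      unfolding c' deg[OF f] using has_degree_not_in_relation_ideal[OF f] ne_zero by blast
  next
    show "coset (generator (e i)) \<in> carrier envelope"
      by (rule q.hom_closed) simp
    show "coset (generator (e i)) \<noteq> \<zero>\<^bsub>envelope\<^esub>"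
      using has_degree_not_in_relation_ideal[OF gen] ne_zero by blast
    show "0 < deg (coset (generator (e i)))"
      using deg[OF gen] by simp
  qed
qed

text \<open>
  All generators vanish modulo the relations, so an element of the free algebra is congruent to
  its constant term.
\<close>

lemma semiperfect_envelope_if_trivial:
  assumes "(UNIV :: 'l set) = {0}"
  shows "semiperfect_ring envelope"
proof -
  interpret q: ring_hom_ring free_ring envelope coset
    by (rule coset_ring_hom)
  have gen: "generator x \<in> relation_ideal" for x
  proof -
    have "x = 0" using assms by blast
    then show ?thesis
      using generator_zero_in_relation_ideal by simp
  qed
  have const: "f - scalar (Poly_Mapping.lookup f 0) \<in> relation_ideal" for f
  proof (rule pm_linear_span_subset[where T = "\<lambda>f. f - scalar (Poly_Mapping.lookup f 0)", OF _ subspace_relation_ideal span_mon_UNIV])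
    show "pm_linear (\<lambda>f. f - scalar (Poly_Mapping.lookup f 0))"
      by (rule pm_linearI) (simp_all add: lookup_add lookup_pm_scale scalar_def single_add
          pm.scale_right_diff_distrib, simp add: pm_scale_def mult_single)
    have "mon (Letters xs) - scalar (Poly_Mapping.lookup (mon (Letters xs)) 0) \<in> relation_ideal" for xs
    proof (cases xs)
      case Nil
      then show ?thesis
        by (simp add: scalar_def relation_ideal_zero flip: zero_free_monoid_def)
    next
      case (Cons x ys)
      have "generator x * mon (Letters ys) \<in> relation_ideal"
        by (rule relation_ideal_mult_right[OF gen])
      then show ?thesis
        by (simp add: Cons generator_def mult_single plus_free_monoid_def scalar_def
            lookup_single zero_free_monoid_def)
    qed
    then have "mon w - scalar (Poly_Mapping.lookup (mon w) 0) \<in> relation_ideal" for w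
      by (cases w) simp
    then show "s - scalar (Poly_Mapping.lookup s 0) \<in> relation_ideal" if "s \<in> range mon" for s
      using that by blast
  qed
  show ?thesis
  proof (rule q.S.semiperfect_if_division_ring)
    fix c assume c: "c \<in> carrier envelope"
    then obtain f where "c = coset f"
      by (rule q.R.carrier_quot_obtain)
    then obtain a where a: "c = coset (scalar a)"
      using const[of f] coset_eq_iff by blast
    show "c = \<zero>\<^bsub>envelope\<^esub> \<or> c \<in> Units envelope"
    proof (cases "a = 0")
      case True
      then show ?thesis by (simp add: a coset_zero scalar_def)
    next
      case False
      have "coset (scalar (inverse a)) \<in> carrier envelope"
        by (rule q.hom_closed) simp
      moreover have "scalar (inverse a) * scalar a = (1 :: ('l, 'k) free_algebra)"
          "scalar a * scalar (inverse a) = (1 :: ('l, 'k) free_algebra)"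
        using False by (simp_all add: scalar_def mult_single)
      ultimately have "c \<in> Units envelope"
        using c coset_mult coset_one unfolding Units_def a by (smt (verit) mem_Collect_eq)
      then show ?thesis ..
    qed
  qed
qed

end

theorem corollary2p3:
  fixes scale :: "'k::field \<Rightarrow> 'l::ab_group_add \<Rightarrow> 'l"
    and bracket :: "'l \<Rightarrow> 'l \<Rightarrow> 'l"
  assumes "lie_algebra scale bracket"
  shows "semiperfect_ring (universal_enveloping_algebra scale bracket)
    \<longleftrightarrow> (UNIV :: 'l set) = {0}"
proof -
  interpret lie_algebra scale bracket by (rule assms)
  define B where "B = extend_basis {}"
  have B: "independent B" "span B = UNIV"
    unfolding B_def using independent_extend_basis[OF independent_empty] span_extend_basis[OF independent_empty] .
  have image: "underlying ` (underlying -` B) = B"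
    by (rule surj_image_vimage_eq) (metis surjI well_ordered.sel)
  interpret lie_algebra_with_basis scale bracket underlying "underlying -` B"
    by unfold_locales (unfold image, auto intro!: inj_onI B dest: well_ordered.expand)
  show ?thesis
  proof
    assume "semiperfect_ring (universal_enveloping_algebra scale bracket)"
    then have "underlying -` B = {}"
      using not_semiperfect_envelope by (auto simp: universal_enveloping_algebra_eq)
    then have "B = {}" using image by simp
    then show "(UNIV :: 'l set) = {0}" using B(2) by simp
  qed (simp add: universal_enveloping_algebra_eq semiperfect_envelope_if_trivial)
qed

end
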